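(* Suppose the labeled $n$-dimensional unoriented grid satisfies the following assumption: for every port $\ell\in\{1,\dots,2n\}$, every positive integer $z$, and every sequence of cells $c_0,\dots,c_z$ such that for each $0\le j\le z-1$ the cell $c_{j+1}$ is reached by leaving $c_j$ via port $\ell$, we have $c_0\neq c_z$. Then, for every positive integer $n$, $3$ agents governed by deterministic finite automata in the synchronous model suffice to explore any such $n$-dimensional unoriented grid, and $4$ such agents suffice in the semi-synchronous model.
   Context: The $n$-dimensional grid has vertex set (cells) $\mathbb{Z}^n$; two cells are adjacent if they differ by exactly $1$ in exactly one coordinate. In the unoriented grid, each endpoint of each edge carries a label (port) from $\{1,\dots,2n\}$ such that at each cell the $2n$ incident edges carry pairwise distinct labels at that cell; no other consistency between labels of different cells is assumed. There are $m$ agents, all initially in the same cell (the origin); agents cannot distinguish cells. Each agent is governed by the same deterministic finite automaton with finite state set $Q$ (agents may start in different initial states). In each look-compute-move cycle, an agent in state $q$ observes the set of states of agents in its cell and, for each port of its cell, the label at the other endpoint of the corresponding edge; based on this it moves to a new state and either leaves the cell via a chosen port or stays. Time proceeds in discrete steps; each active agent performs one atomic cycle per step. In the synchronous model all agents are active in every step; in the semi-synchronous model an adversary chooses in each step an arbitrary subset of active agents, subject to each agent being active infinitely often. The grid is explored if every cell is eventually visited by some agent (for every admissible schedule in the semi-synchronous model). *)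

theory Defs
  imports Main
begin

type_synonym cell = "nat \<Rightarrow> int"

definition cells :: "nat \<Rightarrow> cell set" where
  "cells n = {c. \<forall>i\<ge>n. c i = 0}"

definition origin :: cell where
  "origin = (\<lambda>_. 0)"

definition adj :: "nat \<Rightarrow> cell \<Rightarrow> cell \<Rightarrow> bool" where
  "adj n c d \<longleftrightarrow> (\<exists>i<n. \<bar>d i - c i\<bar> = 1 \<and> (\<forall>j. j \<noteq> i \<longrightarrow> d j = c j))"

definition neighbours :: "nat \<Rightarrow> cell \<Rightarrow> cell set" where
  "neighbours n c = {d. adj n c d}"

text \<open>A port labelling: lab c d is the label at c of the edge {c,d}. At every cell the
  2n incident edges carry pairwise distinct labels from {1..2n}.\<close>
definition valid_labelling :: "nat \<Rightarrow> (cell \<Rightarrow> cell \<Rightarrow> nat) \<Rightarrow> bool" where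
  "valid_labelling n lab \<longleftrightarrow> (\<forall>c\<in>cells n. bij_betw (lab c) (neighbours n c) {1..2*n})"

definition nbr :: "nat \<Rightarrow> (cell \<Rightarrow> cell \<Rightarrow> nat) \<Rightarrow> cell \<Rightarrow> nat \<Rightarrow> cell" where
  "nbr n lab c l = (THE d. adj n c d \<and> lab c d = l)"

definition no_port_cycle :: "nat \<Rightarrow> (cell \<Rightarrow> cell \<Rightarrow> nat) \<Rightarrow> bool" where
  "no_port_cycle n lab \<longleftrightarrow>
     (\<forall>l\<in>{1..2*n}. \<forall>z::nat. z > 0 \<longrightarrow> (\<forall>cs :: nat \<Rightarrow> cell.
        cs 0 \<in> cells n \<longrightarrow> (\<forall>j<z. cs (Suc j) = nbr n lab (cs j) l) \<longrightarrow> cs 0 \<noteq> cs z))"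

text \<open>Automata: states are natural numbers from a finite set Q. The transition function
  receives the current state, the set of states of agents in the cell, and the observation
  of ports (for port p in {1..2n}, the label at the other endpoint of the edge with port p;
  0 outside {1..2n}). It returns the new state and a move: 0 = stay, p in {1..2n} = leave
  via port p (any other value is treated as staying).\<close>
type_synonym automaton = "nat \<Rightarrow> nat set \<Rightarrow> (nat \<Rightarrow> nat) \<Rightarrow> nat \<times> nat"

definition is_automaton :: "nat \<Rightarrow> nat set \<Rightarrow> automaton \<Rightarrow> bool" where
  "is_automaton n Q \<delta> \<longleftrightarrow> finite Q \<and>
     (\<forall>q\<in>Q. \<forall>S obs. fst (\<delta> q S obs) \<in> Q)"

type_synonym config = "(nat \<Rightarrow> cell) \<times> (nat \<Rightarrow> nat)"

definition observation :: "nat \<Rightarrow> (cell \<Rightarrow> cell \<Rightarrow> nat) \<Rightarrow> cell \<Rightarrow> nat \<Rightarrow> nat" where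
  "observation n lab c = (\<lambda>p. if p \<in> {1..2*n} then lab (nbr n lab c p) c else 0)"

definition cycle :: "nat \<Rightarrow> (cell \<Rightarrow> cell \<Rightarrow> nat) \<Rightarrow> automaton \<Rightarrow> nat \<Rightarrow> config \<Rightarrow> nat \<Rightarrow> nat \<times> cell" where
  "cycle n lab \<delta> m conf i =
     (let pos = fst conf; st = snd conf; c = pos i;
          S = {st j | j. j < m \<and> pos j = c};
          r = \<delta> (st i) S (observation n lab c)
      in (fst r, if snd r \<in> {1..2*n} then nbr n lab c (snd r) else c))"

definition step :: "nat \<Rightarrow> (cell \<Rightarrow> cell \<Rightarrow> nat) \<Rightarrow> automaton \<Rightarrow> nat \<Rightarrow> nat set \<Rightarrow> config \<Rightarrow> config" where
  "step n lab \<delta> m A conf =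
     ((\<lambda>i. if i \<in> A then snd (cycle n lab \<delta> m conf i) else fst conf i),
      (\<lambda>i. if i \<in> A then fst (cycle n lab \<delta> m conf i) else snd conf i))"

fun run :: "nat \<Rightarrow> (cell \<Rightarrow> cell \<Rightarrow> nat) \<Rightarrow> automaton \<Rightarrow> nat \<Rightarrow> (nat \<Rightarrow> nat) \<Rightarrow> (nat \<Rightarrow> nat set) \<Rightarrow> nat \<Rightarrow> config" where
  "run n lab \<delta> m init sched 0 = ((\<lambda>_. origin), init)"
| "run n lab \<delta> m init sched (Suc t) = step n lab \<delta> m (sched t) (run n lab \<delta> m init sched t)"

definition explored :: "nat \<Rightarrow> (cell \<Rightarrow> cell \<Rightarrow> nat) \<Rightarrow> automaton \<Rightarrow> nat \<Rightarrow> (nat \<Rightarrow> nat) \<Rightarrow> (nat \<Rightarrow> nat set) \<Rightarrow> bool" where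
  "explored n lab \<delta> m init sched \<longleftrightarrow>
     (\<forall>c\<in>cells n. \<exists>t i. i < m \<and> fst (run n lab \<delta> m init sched t) i = c)"

definition fair_schedule :: "nat \<Rightarrow> (nat \<Rightarrow> nat set) \<Rightarrow> bool" where
  "fair_schedule m sched \<longleftrightarrow> (\<forall>i<m. \<forall>t. \<exists>t'\<ge>t. i \<in> sched t')"

definition sync_schedule :: "nat \<Rightarrow> nat \<Rightarrow> nat set" where
  "sync_schedule m = (\<lambda>_. {..<m})"

definition sync_explorable :: "nat \<Rightarrow> nat \<Rightarrow> bool" where
  "sync_explorable n m \<longleftrightarrow>
     (\<exists>Q \<delta> init. is_automaton n Q \<delta> \<and> (\<forall>i<m. init i \<in> Q) \<and>
        (\<forall>lab. valid_labelling n lab \<longrightarrow> no_port_cycle n lab \<longrightarrow>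
            explored n lab \<delta> m init (sync_schedule m)))"

definition ssync_explorable :: "nat \<Rightarrow> nat \<Rightarrow> bool" where
  "ssync_explorable n m \<longleftrightarrow>
     (\<exists>Q \<delta> init. is_automaton n Q \<delta> \<and> (\<forall>i<m. init i \<in> Q) \<and>
        (\<forall>lab. valid_labelling n lab \<longrightarrow> no_port_cycle n lab \<longrightarrow>
           (\<forall>sched. fair_schedule m sched \<longrightarrow> explored n lab \<delta> m init sched)))"

end

(* An agent stores a port next to its cell, so it lives on corners (cell, port). Acyclicity of port 1
   makes the edges with label 1 an infinite forest, and the Euler tour of this forest is a local
   permutation of the corners without periodic points. A number d at a base corner x is therefore
   representable by an agent d steps further along the tour. Both teams of agents can move the base
   by a local move while multiplying d by a fraction k / m that depends on d modulo a constant.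
   Such a machine computes the last nonzero base-5 digits of 1, 2, 3, ..., and the base moves
   selected by these digits run through all words in two generators of a transitive action. *)

theory Submission
  imports Defs
begin

section \<open>Corners and the Euler tour of the port-1 forest\<close>

text \<open>The map that leaves a cell through port 1 need not be injective, so an agent that
  follows it has no rule for walking back. Its Euler tour is invertible by a local rule: the label
  at the far end of an edge shows whether the edge belongs to the forest and at which port the agent
  arrives. Cells are indistinguishable, so the only unbounded memory is the relative position of
  agents on the tour, and a small team can maintain just one such distance. Several registers
  therefore have to share one number, as prime exponents in the manner of Minsky machines. The word
  being followed is not stored either. The order given by last nonzero digits undoes every excursion
  by itself, so that the round number is the whole memory. What separates the two models is how a
  distance is multiplied: with a common clock two agents of different speeds do it by meeting at the
  right corner, whereas without one a further agent has to carry out every single displacement of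
  the others.\<close>

datatype mv = Stay | Pi | PiInv | Rho | RhoInv | Tau

fun minv :: "mv \<Rightarrow> mv" where
  "minv Stay = Stay"
| "minv Pi = PiInv"
| "minv PiInv = Pi"
| "minv Rho = RhoInv"
| "minv RhoInv = Rho"
| "minv Tau = Tau"

definition rot :: "nat \<Rightarrow> nat \<Rightarrow> nat" where
  "rot n p = (if p = 2 * n then 1 else Suc p)"

definition rotinv :: "nat \<Rightarrow> nat \<Rightarrow> nat" where
  "rotinv n p = (if p = 1 then 2 * n else p - 1)"

text \<open>The result is the new port together with the exit port, where 0 means staying in the cell.\<close>
fun portmove :: "nat \<Rightarrow> mv \<Rightarrow> nat \<Rightarrow> (nat \<Rightarrow> nat) \<Rightarrow> nat \<times> nat" where
  "portmove n Stay p obs = (p, 0)"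
| "portmove n Rho p obs = (rot n p, 0)"
| "portmove n RhoInv p obs = (rotinv n p, 0)"
| "portmove n Tau p obs = (obs p, p)"
| "portmove n Pi p obs = (if p = 1 \<or> obs p = 1 then (rot n (obs p), p) else (rot n p, 0))"
| "portmove n PiInv p obs =
     (let p' = rotinv n p in if p' = 1 \<or> obs p' = 1 then (obs p', p') else (p', 0))"

definition act :: "nat \<Rightarrow> (cell \<Rightarrow> cell \<Rightarrow> nat) \<Rightarrow> mv \<Rightarrow> cell \<times> nat \<Rightarrow> cell \<times> nat" where
  "act n lab mv x = (let r = portmove n mv (snd x) (observation n lab (fst x)) in
     (if snd r \<in> {1..2*n} then nbr n lab (fst x) (snd r) else fst x, fst r))"

definition corners :: "nat \<Rightarrow> (cell \<times> nat) set" where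
  "corners n = cells n \<times> {1..2*n}"

lemma adj_sym: "adj n c d \<longleftrightarrow> adj n d c"
  unfolding adj_def by (metis abs_minus_commute)

lemma adj_in_cells: "adj n c d \<Longrightarrow> c \<in> cells n \<Longrightarrow> d \<in> cells n"
  unfolding adj_def cells_def by fastforce

lemma adj_irrefl: "adj n c d \<Longrightarrow> c \<noteq> d"
  unfolding adj_def by auto

lemma rot_in: "1 \<le> n \<Longrightarrow> p \<in> {1..2*n} \<Longrightarrow> rot n p \<in> {1..2*n}"
  by (auto simp: rot_def)

lemma rotinv_in: "1 \<le> n \<Longrightarrow> p \<in> {1..2*n} \<Longrightarrow> rotinv n p \<in> {1..2*n}"
  by (auto simp: rotinv_def)

lemma rotinv_rot: "p \<in> {1..2*n} \<Longrightarrow> rotinv n (rot n p) = p"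
  by (auto simp: rot_def rotinv_def)

lemma rot_rotinv: "p \<in> {1..2*n} \<Longrightarrow> rot n (rotinv n p) = p"
  by (auto simp: rot_def rotinv_def)

lemma rot_neq: "1 \<le> n \<Longrightarrow> p \<in> {1..2*n} \<Longrightarrow> rot n p \<noteq> p"
  by (auto simp: rot_def)

lemma rotinv_neq: "1 \<le> n \<Longrightarrow> p \<in> {1..2*n} \<Longrightarrow> rotinv n p \<noteq> p"
  by (auto simp: rotinv_def)

section \<open>Crossing and turning as permutations of the corners\<close>

locale grid =
  fixes n :: nat and lab :: "cell \<Rightarrow> cell \<Rightarrow> nat"
  assumes n: "1 \<le> n" and valid: "valid_labelling n lab" and acyclic: "no_port_cycle n lab"
begin

abbreviation nb where "nb \<equiv> nbr n lab"

definition cross :: "cell \<times> nat \<Rightarrow> cell \<times> nat" where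
  "cross x = (nb (fst x) (snd x), lab (nb (fst x) (snd x)) (fst x))"

text \<open>Crossing restricted to the forest edges. This involution followed by the rotation
  \<open>turn\<close> is the face permutation of a combinatorial map; on a forest it walks around
  the trees.\<close>

definition tree_cross :: "cell \<times> nat \<Rightarrow> cell \<times> nat" where
  "tree_cross x = (if snd x = 1 \<or> snd (cross x) = 1 then cross x else x)"

definition turn :: "cell \<times> nat \<Rightarrow> cell \<times> nat" where
  "turn x = (fst x, rot n (snd x))"

definition turninv :: "cell \<times> nat \<Rightarrow> cell \<times> nat" where
  "turninv x = (fst x, rotinv n (snd x))"

lemma bij: "c \<in> cells n \<Longrightarrow> bij_betw (lab c) (neighbours n c) {1..2*n}"
  using valid by (auto simp: valid_labelling_def)

lemma nb_eq: "c \<in> cells n \<Longrightarrow> adj n c d \<Longrightarrow> nb c (lab c d) = d"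
  unfolding nbr_def
  by (rule the_equality)
    (use bij[of c] in \<open>auto simp: bij_betw_def inj_on_def neighbours_def\<close>)

lemma ex_adj: "c \<in> cells n \<Longrightarrow> p \<in> {1..2*n} \<Longrightarrow> \<exists>d. adj n c d \<and> lab c d = p"
  using bij[of c] unfolding bij_betw_def neighbours_def by (metis imageE mem_Collect_eq)

lemma
  assumes "c \<in> cells n" "p \<in> {1..2*n}"
  shows adj_nb: "adj n c (nb c p)" and lab_nb: "lab c (nb c p) = p"
  using ex_adj[OF assms] nb_eq[OF assms(1)] by auto

lemma lab_in: "c \<in> cells n \<Longrightarrow> adj n c d \<Longrightarrow> lab c d \<in> {1..2*n}"
  using bij[of c] unfolding bij_betw_def neighbours_def by blast

lemma nb_in: "c \<in> cells n \<Longrightarrow> p \<in> {1..2*n} \<Longrightarrow> nb c p \<in> cells n"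
  using adj_nb adj_in_cells by blast

lemma cross_in: "x \<in> corners n \<Longrightarrow> cross x \<in> corners n"
  using nb_in adj_nb adj_sym lab_in unfolding cross_def corners_def by (cases x) fastforce

lemma cross_cross: "x \<in> corners n \<Longrightarrow> cross (cross x) = x"
  using nb_in[of "fst x" "snd x"] adj_nb[of "fst x" "snd x"] lab_nb[of "fst x" "snd x"]
    nb_eq[of "nb (fst x) (snd x)" "fst x"]
  unfolding cross_def corners_def by (cases x) (simp add: adj_sym)

lemma fst_cross_neq: "x \<in> corners n \<Longrightarrow> fst (cross x) \<noteq> fst x"
  using adj_nb adj_irrefl unfolding cross_def corners_def by (cases x) fastforce

lemma tree_cross_in: "x \<in> corners n \<Longrightarrow> tree_cross x \<in> corners n"
  by (simp add: tree_cross_def cross_in)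

lemma tree_cross_tree_cross: "x \<in> corners n \<Longrightarrow> tree_cross (tree_cross x) = x"
  by (auto simp: tree_cross_def cross_cross)

lemma turn_in: "x \<in> corners n \<Longrightarrow> turn x \<in> corners n"
  using rot_in[OF n] by (auto simp: turn_def corners_def)

lemma turninv_in: "x \<in> corners n \<Longrightarrow> turninv x \<in> corners n"
  using rotinv_in[OF n] by (auto simp: turninv_def corners_def)

lemma turninv_turn: "x \<in> corners n \<Longrightarrow> turninv (turn x) = x"
  using rotinv_rot by (auto simp: turninv_def turn_def corners_def)

lemma turn_turninv: "x \<in> corners n \<Longrightarrow> turn (turninv x) = x"
  using rot_rotinv by (auto simp: turninv_def turn_def corners_def)

lemma act_simps:
  assumes "x \<in> corners n"
  shows "act n lab Stay x = x" "act n lab Rho x = turn x" "act n lab RhoInv x = turninv x"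
    "act n lab Tau x = cross x" "act n lab Pi x = turn (tree_cross x)"
    "act n lab PiInv x = tree_cross (turninv x)"
  using assms turninv_in[OF assms]
  by (auto simp: act_def corners_def observation_def cross_def tree_cross_def turn_def
      turninv_def Let_def)

lemma act_in: "x \<in> corners n \<Longrightarrow> act n lab m x \<in> corners n"
  by (cases m) (simp_all add: act_simps turn_in turninv_in cross_in tree_cross_in)

lemma act_minv: "x \<in> corners n \<Longrightarrow> act n lab (minv m) (act n lab m x) = x"
  by (cases m) (simp_all add: act_simps turn_in turninv_in cross_in tree_cross_in
      turn_turninv turninv_turn cross_cross tree_cross_tree_cross)

section \<open>Aperiodicity of the tour\<close>

abbreviation tour where "tour \<equiv> act n lab Pi"

lemma tour_pow_in: "x \<in> corners n \<Longrightarrow> (tour ^^ i) x \<in> corners n"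
  by (induction i) (auto simp: act_in)

abbreviation up where "up c \<equiv> nb c 1"

lemma up_in: "c \<in> cells n \<Longrightarrow> up c \<in> cells n"
  using nb_in n by simp

lemma up_pow_in: "c \<in> cells n \<Longrightarrow> (up ^^ i) c \<in> cells n"
  by (induction i) (auto simp: up_in simp del: One_nat_def)

lemma up_acyclic:
  assumes "c \<in> cells n" "0 < z" shows "(up ^^ z) c \<noteq> c"
proof -
  have "cs 0 \<in> cells n \<Longrightarrow> \<forall>j<z. cs (Suc j) = up (cs j) \<Longrightarrow> cs 0 \<noteq> cs z" for cs
    using acyclic[unfolded no_port_cycle_def, rule_format, of 1 z cs] assms(2) n by auto
  from this[of "\<lambda>i. (up ^^ i) c"] show ?thesis using assms(1) by auto
qed

text \<open>A closed tour that descends from v to a child u has to climb back, and the only edge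
  leaving the subtree below u is the one between u and v; so it continues at v with the next port.\<close>
lemma closed_tour_next_port:
  assumes x: "x \<in> corners n" and z: "0 < z" "(tour ^^ z) x = x"
    and vp: "x = (v, p)" and p: "p \<noteq> 1"
  shows "\<exists>i. (tour ^^ i) x = (v, rot n p)"
proof (cases "snd (cross x) = 1")
  case False
  then have "tour x = (v, rot n p)"
    using p vp unfolding act_simps(5)[OF x] tree_cross_def turn_def by simp
  then show ?thesis by (metis funpow_0 funpow.simps(2) comp_apply)
next
  case True
  define u where "u = fst (cross x)"
  \<comment> \<open>The subtree below \<open>u\<close>. Acyclicity keeps \<open>v\<close>, the
    parent of \<open>u\<close>, outside.\<close>
  define D where "D = {y. \<exists>i. (up ^^ i) y = u}"
  have cu: "cross x = (u, 1)" using True by (simp add: u_def prod_eq_iff)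
  have uin: "(u, 1) \<in> corners n" using cross_in[OF x] cu by simp
  have cross_u: "cross (u, 1) = (v, p)" using cross_cross[OF x] cu vp by simp
  then have up_u: "up u = v" by (simp add: cross_def)
  have u_D: "u \<in> D" unfolding D_def by (auto intro: exI[of _ 0])
  have v_D: "v \<notin> D"
  proof
    assume "v \<in> D"
    then obtain i where "(up ^^ i) v = u" unfolding D_def by auto
    then have "(up ^^ Suc i) u = u" by (simp only: funpow_Suc_right comp_apply up_u)
    then show False using up_acyclic[of u "Suc i"] uin by (auto simp: corners_def)
  qed
  have 1: "fst ((tour ^^ 1) x) \<in> D"
    using p by (simp add: act_simps x tree_cross_def turn_def cu u_D)
  have "z \<noteq> 1" using 1 v_D z vp by auto
  then have "\<exists>i\<ge>1. i < z \<and> fst ((tour ^^ i) x) \<in> D \<and> fst ((tour ^^ Suc i) x) \<notin> D"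
  proof -
    have "\<exists>j<z-1. fst ((tour ^^ Suc j) x) \<in> D \<and> fst ((tour ^^ Suc (Suc j)) x) \<notin> D"
    proof (rule ccontr)
      assume *: "\<not> ?thesis"
      have "j \<le> z - 1 \<Longrightarrow> fst ((tour ^^ Suc j) x) \<in> D" for j
        using * 1 by (induction j) auto
      from this[of "z-1"] show False using z vp v_D by auto
    qed
    then show ?thesis by (metis One_nat_def Suc_le_mono le0 less_diff_conv add.commute plus_1_eq_Suc)
  qed
  then obtain i where i: "fst ((tour ^^ i) x) \<in> D" "fst (tour ((tour ^^ i) x)) \<notin> D" by auto
  define y where "y = (tour ^^ i) x"
  have y: "y \<in> corners n" "fst y \<in> D" "fst (tour y) \<notin> D"
    using i tour_pow_in[OF x] by (auto simp: y_def)
  have ft: "fst (tour y) = fst (tree_cross y)" by (simp add: act_simps y turn_def)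
  then have tc: "tree_cross y = cross y" using y by (auto simp: tree_cross_def)
  obtain k where k: "(up ^^ k) (fst y) = u" using y by (auto simp: D_def)
  \<comment> \<open>The tour leaves \<open>D\<close> along a forest edge. If that edge did not go up
    from \<open>y\<close>, its far end would be a child of a cell in \<open>D\<close> and hence in
    \<open>D\<close> itself.\<close>
  have "snd y = 1"
  proof (rule ccontr)
    assume "snd y \<noteq> 1"
    then have "snd (cross y) = 1" using tc ft y unfolding tree_cross_def by (metis (full_types))
    then have "up (fst (cross y)) = fst y"
      using cross_cross[OF y(1)] unfolding cross_def by (metis fst_conv snd_conv)
    then have "(up ^^ Suc k) (fst (cross y)) = u"
      using k by (simp only: funpow_Suc_right comp_apply)
    then have "fst (cross y) \<in> D" unfolding D_def by blast
    then show False using y(3) ft tc by simp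
  qed
  \<comment> \<open>Going up from a proper descendant of \<open>u\<close> stays in
    \<open>D\<close>.\<close>
  have "k = 0"
  proof (rule ccontr)
    assume "k \<noteq> 0"
    then obtain k' where "k = Suc k'" by (cases k) auto
    then have "(up ^^ k') (up (fst y)) = u" using k by (simp only: funpow_Suc_right comp_apply)
    then have "up (fst y) \<in> D" unfolding D_def by blast
    moreover have "fst (tour y) = up (fst y)"
      using ft tc \<open>snd y = 1\<close> by (simp add: cross_def)
    ultimately show False using y(3) by simp
  qed
  then have "y = (u, 1)" using k \<open>snd y = 1\<close> by (simp add: prod_eq_iff)
  then have "tour y = (v, rot n p)" using tc y(1) cross_u by (simp add: act_simps turn_def)
  then show ?thesis by (intro exI[of _ "Suc i"]) (simp add: y_def)
qed

lemma closed_tour_shift: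
  assumes "(tour ^^ z) x = x" shows "(tour ^^ z) ((tour ^^ i) x) = (tour ^^ i) x"
  using assms by (metis add.commute comp_apply funpow_add)

lemma closed_tour_port_1:
  assumes x: "(v, p) \<in> corners n" and z: "0 < z" "(tour ^^ z) (v, p) = (v, p)"
  shows "\<exists>i. (tour ^^ i) (v, p) = (v, 1)"
  using assms
proof (induction "2 * n - p" arbitrary: p rule: less_induct)
  case less
  show ?case
  proof (cases "p = 1")
    case True
    then show ?thesis by (intro exI[of _ 0]) auto
  next
    case False
    then obtain i where i: "(tour ^^ i) (v, p) = (v, rot n p)"
      using closed_tour_next_port[OF less.prems(1-3) refl] by blast
    show ?thesis
    proof (cases "p = 2 * n")
      case True
      then show ?thesis using i by (auto simp: rot_def)
    next
      case p: False
      then have *: "2 * n - rot n p < 2 * n - p" "(v, rot n p) \<in> corners n"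
        using less.prems(1) by (auto simp: rot_def corners_def)
      have "(tour ^^ z) (v, rot n p) = (v, rot n p)"
        using closed_tour_shift[OF less.prems(3), of i] i by simp
      from less.hyps[OF *(1) *(2) less.prems(2) this]
      obtain j where "(tour ^^ j) (v, rot n p) = (v, 1)" by blast
      then have "(tour ^^ (j + i)) (v, p) = (v, 1)" by (simp add: funpow_add i)
      then show ?thesis by blast
    qed
  qed
qed

text \<open>A closed tour meets port 1 of every cell it visits, so its finite set of cells is closed
  under \<open>up\<close>; but the iterates of \<open>up\<close> are pairwise distinct.\<close>

lemma tour_aperiodic:
  assumes x: "x \<in> corners n" and z: "0 < z"
  shows "(tour ^^ z) x \<noteq> x"
proof
  assume per: "(tour ^^ z) x = x"
  define V where "V = fst ` (\<lambda>i. (tour ^^ i) x) ` {..<z}"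
  have mod: "(tour ^^ i) x = (tour ^^ (i mod z)) x" for i
    using per by (simp add: funpow_mod_eq)
  have V: "fst ((tour ^^ i) x) \<in> V" for i
    unfolding V_def using mod[of i] z by (auto intro!: image_eqI[of _ _ "i mod z"] simp del: funpow_mod_eq)
  have step: "\<exists>j. fst ((tour ^^ j) x) = up (fst ((tour ^^ i) x))" for i
  proof -
    define v where "v = fst ((tour ^^ i) x)"
    define p where "p = snd ((tour ^^ i) x)"
    have vp: "(tour ^^ i) x = (v, p)" by (simp add: v_def p_def)
    have "(v, p) \<in> corners n" using tour_pow_in[OF x, of i] vp by simp
    from closed_tour_port_1[OF this z] closed_tour_shift[OF per, of i] vp
    obtain j where j: "(tour ^^ j) (v, p) = (v, 1)" by auto
    then have ji: "(tour ^^ (j + i)) x = (v, 1)" by (simp add: funpow_add vp)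
    then have "(v, 1) \<in> corners n" using tour_pow_in[OF x] by metis
    then have "fst (tour (v, 1)) = up v"
      by (simp add: act_simps turn_def tree_cross_def) (simp add: cross_def)
    then have "fst ((tour ^^ Suc (j + i)) x) = up v" using ji by simp
    then show ?thesis unfolding v_def by blast
  qed
  have "\<exists>j. fst ((tour ^^ j) x) = (up ^^ i) (fst x)" for i
  proof (induction i)
    case 0
    show ?case by (auto intro: exI[of _ 0])
  next
    case (Suc i)
    then obtain j where "fst ((tour ^^ j) x) = (up ^^ i) (fst x)" ..
    with step[of j] show ?case by simp
  qed
  then have "range (\<lambda>i. (up ^^ i) (fst x)) \<subseteq> V" using V by (metis image_subsetI)
  moreover have "finite V" by (simp add: V_def)
  moreover have "inj (\<lambda>i. (up ^^ i) (fst x))"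
  proof (rule linorder_injI)
    fix i j :: nat assume "i < j"
    then have "(up ^^ j) (fst x) = (up ^^ (j - i)) ((up ^^ i) (fst x))"
      by (metis add.commute comp_apply funpow_add less_imp_add_positive diff_add_inverse)
    then show "(up ^^ i) (fst x) \<noteq> (up ^^ j) (fst x)"
      using up_acyclic[of "(up ^^ i) (fst x)" "j - i"] up_pow_in[of "fst x" i] \<open>i < j\<close> x
      by (auto simp: corners_def)
  qed
  ultimately show False using finite_subset finite_imageD infinite_UNIV_nat by blast
qed

text \<open>Needed to see that an order has been obeyed: a pebble that has executed a proper move is
  no longer at the walker's corner.\<close>

lemma act_neq:
  assumes "x \<in> corners n" "m \<noteq> Stay" shows "act n lab m x \<noteq> x"
proof -
  have pi: "tour y \<noteq> y" if "y \<in> corners n" for y using tour_aperiodic[OF that, of 1] by simp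
  show ?thesis
  proof (cases m)
    case PiInv
    then show ?thesis using pi[OF assms(1)] act_minv[OF assms(1), of PiInv] by auto
  next
    case Tau
    then show ?thesis using fst_cross_neq[OF assms(1)] assms(1) by (auto simp: act_simps)
  qed (use assms pi rot_neq[OF n] rotinv_neq[OF n] in
      \<open>auto simp: act_simps turn_def turninv_def corners_def\<close>)
qed

end

section \<open>Agents on corners\<close>

text \<open>The port component of an agent's corner is kept in its concrete state. Agents react only
  to agents at the same corner, that is, in the same cell and with the same port component.\<close>

type_synonym ('x, 'q) cconf = "(nat \<Rightarrow> 'x) \<times> (nat \<Rightarrow> 'q)"

type_synonym 'q cautomaton = "'q \<Rightarrow> 'q set \<Rightarrow> 'q \<times> mv"

definition view :: "nat \<Rightarrow> ('x, 'q) cconf \<Rightarrow> nat \<Rightarrow> 'q set" where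
  "view m c i = {snd c j | j. j < m \<and> fst c j = fst c i}"

definition cstep ::
    "(mv \<Rightarrow> 'x \<Rightarrow> 'x) \<Rightarrow> 'q cautomaton \<Rightarrow> nat \<Rightarrow> nat set \<Rightarrow> ('x, 'q) cconf \<Rightarrow> ('x, 'q) cconf" where
  "cstep a D m A c =
     ((\<lambda>i. if i \<in> A then a (snd (D (snd c i) (view m c i))) (fst c i) else fst c i),
      (\<lambda>i. if i \<in> A then fst (D (snd c i) (view m c i)) else snd c i))"

fun crun ::
    "(mv \<Rightarrow> 'x \<Rightarrow> 'x) \<Rightarrow> 'q cautomaton \<Rightarrow> nat \<Rightarrow> ('x, 'q) cconf \<Rightarrow> (nat \<Rightarrow> nat set) \<Rightarrow> nat \<Rightarrow> ('x, 'q) cconf" where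
  "crun a D m c sched 0 = c"
| "crun a D m c sched (Suc t) = cstep a D m (sched t) (crun a D m c sched t)"

context grid begin

text \<open>The default port 1 never takes effect on corners. The automaton needs it, because it
  must remain in its finite state set under arbitrary observations.\<close>

lemma act_eq:
  assumes "(c, p) \<in> corners n"
  shows "act n lab mv (c, p) =
    (let r = portmove n mv p (observation n lab c) in
      (if snd r \<in> {1..2*n} then nb c (snd r) else c, if fst r \<in> {1..2*n} then fst r else 1))"
  using act_in[OF assms, of mv] by (auto simp: act_def Let_def corners_def)

end

text \<open>Encoding each candidate state with the agent's own port filters out agents of the same
  cell at other ports, which leaves exactly the view at the corner. The schedule is arbitrary, so
  both models are covered, and the automaton is chosen before the labelling.\<close>

lemma corner_automaton_implementable:
  fixes D :: "'q cautomaton"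
  assumes n: "1 \<le> n" and fin: "finite S"
    and closed: "\<And>q V. q \<in> S \<Longrightarrow> fst (D q V) \<in> S" and q0: "\<And>i. i < m \<Longrightarrow> q0 i \<in> S"
  shows "\<exists>Q \<delta> init. is_automaton n Q \<delta> \<and> (\<forall>i<m. init i \<in> Q) \<and>
    (\<forall>lab sched t i. valid_labelling n lab \<longrightarrow> no_port_cycle n lab \<longrightarrow> i < m \<longrightarrow>
      fst (run n lab \<delta> m init sched t) i =
      fst (fst (crun (act n lab) D m (\<lambda>_. (origin, 1), q0) sched t) i))"
proof -
  define P where "P = {1..2*n}"
  have "finite (P \<times> S)" using fin by (simp add: P_def)
  then obtain enc :: "nat \<times> 'q \<Rightarrow> nat" where enc: "inj_on enc (P \<times> S)"
    using finite_imp_inj_to_nat_seg by blast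
  define dec where "dec = the_inv_into (P \<times> S) enc"
  have dec: "dec (enc (p, q)) = (p, q)" if "p \<in> P" "q \<in> S" for p q
    unfolding dec_def by (rule the_inv_into_f_f[OF enc]) (use that in auto)
  have enc_eq: "enc (p, q) = enc (p', q') \<longleftrightarrow> p = p' \<and> q = q'"
    if "p \<in> P" "q \<in> S" "p' \<in> P" "q' \<in> S" for p q p' q'
    using enc that by (auto simp: inj_on_def)
  define \<delta> :: automaton where "\<delta> = (\<lambda>s V obs.
    let p = fst (dec s); r = D (snd (dec s)) {q \<in> S. enc (p, q) \<in> V}; w = portmove n (snd r) p obs
    in (enc (if fst w \<in> P then fst w else 1, fst r), snd w))"
  have one: "1 \<in> P" using n by (auto simp: P_def)
  have aut: "is_automaton n (enc ` (P \<times> S)) \<delta>"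
    unfolding is_automaton_def
    using fin closed one by (auto simp: P_def[symmetric] \<delta>_def Let_def dec) (auto simp: P_def)
  define init where "init = (\<lambda>i. enc (1, q0 i))"
  define c0 where "c0 = ((\<lambda>_::nat. (origin, 1::nat)), q0)"
  have sim: "fst (run n lab \<delta> m init sched t) i =
        fst (fst (crun (act n lab) D m c0 sched t) i)
      \<and> snd (run n lab \<delta> m init sched t) i =
        enc (snd (fst (crun (act n lab) D m c0 sched t) i),
        snd (crun (act n lab) D m c0 sched t) i)
      \<and> fst (crun (act n lab) D m c0 sched t) i \<in> corners n
      \<and> snd (crun (act n lab) D m c0 sched t) i \<in> S"
    if lab: "valid_labelling n lab" "no_port_cycle n lab" and i: "i < m" for lab sched t i
    using i
  proof (induction t arbitrary: i)
    case 0
    then show ?case using q0 one by (auto simp: c0_def init_def corners_def cells_def origin_def P_def)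
  next
    case (Suc t)
    interpret grid n lab using n lab by unfold_locales
    define R where "R = run n lab \<delta> m init sched t"
    define C where "C = crun (act n lab) D m c0 sched t"
    have IH: "fst R j = fst (fst C j)" "snd R j = enc (snd (fst C j), snd C j)"
      "fst C j \<in> corners n" "snd C j \<in> S" "snd (fst C j) \<in> P" if "j < m" for j
      using Suc.IH[OF that] unfolding R_def C_def by (auto simp: corners_def P_def)
    note i = Suc.prems
    have V: "{q \<in> S. enc (snd (fst C i), q) \<in> {snd R j |j. j < m \<and> fst R j = fst R i}} = view m C i"
      using IH i by (auto simp: view_def enc_eq prod_eq_iff) (metis prod_eqI)
    define r where "r = D (snd C i) (view m C i)"
    define w where "w = portmove n (snd r) (snd (fst C i)) (observation n lab (fst (fst C i)))"
    have "\<delta> (snd R i) {snd R j |j. j < m \<and> fst R j = fst R i} (observation n lab (fst R i)) =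
       (enc (if fst w \<in> P then fst w else 1, fst r), snd w)"
      unfolding \<delta>_def Let_def IH(2)[OF i] dec[OF IH(5)[OF i] IH(4)[OF i]] fst_conv snd_conv
      using V IH i by (simp add: r_def w_def Let_def)
    then have cyc: "cycle n lab \<delta> m R i = (enc (if fst w \<in> P then fst w else 1, fst r),
       if snd w \<in> P then nbr n lab (fst R i) (snd w) else fst R i)"
      unfolding cycle_def Let_def P_def by simp
    have act: "act n lab (snd r) (fst C i) =
       (if snd w \<in> P then nbr n lab (fst R i) (snd w) else fst R i, if fst w \<in> P then fst w else 1)"
      using act_eq[of "fst (fst C i)" "snd (fst C i)" "snd r"] IH[OF i]
      by (simp add: w_def P_def Let_def)
    have "act n lab (snd r) (fst C i) \<in> corners n" "fst r \<in> S"
      using act_in IH[OF i] closed by (auto simp: r_def)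
    then show ?case
      using IH[OF i] act cyc
      by (simp add: R_def[symmetric] C_def[symmetric] step_def cstep_def r_def[symmetric])
  qed
  show ?thesis
    by (rule exI[of _ "enc ` (P \<times> S)"], rule exI[of _ \<delta>], rule exI[of _ init])
      (use aut sim q0 one in \<open>auto simp: init_def c0_def\<close>)
qed

subsection \<open>Reaching every cell by words in Rho and Tau\<close>

fun act_word :: "(mv \<Rightarrow> 'x \<Rightarrow> 'x) \<Rightarrow> bool list \<Rightarrow> 'x \<Rightarrow> 'x" where
  "act_word a [] x = x"
| "act_word a (b # w) x = act_word a w (a (if b then Tau else Rho) x)"

lemma act_word_append: "act_word a (u @ w) x = act_word a w (act_word a u x)"
  by (induction u arbitrary: x) auto

context grid begin

lemma act_word_rot:
  assumes "c \<in> cells n" "p \<in> {1..2*n}" "p' \<in> {1..2*n}"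
  shows "\<exists>w. act_word (act n lab) w (c, p) = (c, p')"
proof -
  have up: "\<exists>w. act_word (act n lab) w (c, p) = (c, p + k)" if "p \<in> {1..2*n}" "p + k \<le> 2 * n" for p k
    using that(2)
  proof (induction k)
    case 0
    show ?case by (rule exI[of _ "[]"]) simp
  next
    case (Suc k)
    then obtain w where w: "act_word (act n lab) w (c, p) = (c, p + k)" by auto
    have "act n lab Rho (c, p + k) = (c, p + Suc k)"
      using Suc.prems that(1) assms(1) by (simp add: act_simps corners_def turn_def rot_def)
    with w show ?case by (intro exI[of _ "w @ [False]"]) (simp add: act_word_append)
  qed
  obtain u where u: "act_word (act n lab) u (c, p) = (c, 2 * n)"
    using up[of p "2 * n - p"] assms by auto
  obtain w where w: "act_word (act n lab) w (c, 1) = (c, p')"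
    using up[of 1 "p' - 1"] assms n by auto
  have "act n lab Rho (c, 2 * n) = (c, 1)"
    using assms(1) n by (simp add: act_simps corners_def turn_def rot_def)
  with u w show ?thesis by (intro exI[of _ "u @ [False] @ w"]) (simp add: act_word_append)
qed

lemma act_word_adj:
  assumes "c \<in> cells n" "p \<in> {1..2*n}" "adj n c d"
  shows "\<exists>w q. act_word (act n lab) w (c, p) = (d, q) \<and> q \<in> {1..2*n}"
proof -
  have l: "lab c d \<in> {1..2*n}" using lab_in assms by blast
  then obtain w where w: "act_word (act n lab) w (c, p) = (c, lab c d)"
    using act_word_rot assms by blast
  have "act n lab Tau (c, lab c d) = (d, lab d c)"
    using nb_eq[OF assms(1,3)] l assms(1) by (simp add: act_simps corners_def cross_def)
  moreover have "lab d c \<in> {1..2*n}"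
    using lab_in[of d c] adj_in_cells[OF assms(3,1)] assms(3) adj_sym by blast
  ultimately show ?thesis using w
    by (intro exI[of _ "w @ [True]"]) (auto simp: act_word_append)
qed

text \<open>The arrival port is dictated by the labelling, hence the existential \<open>q\<close>;
  rotating at the cell then prepares the next crossing.\<close>

lemma act_word_reaches:
  assumes "c \<in> cells n"
  shows "\<exists>w q. act_word (act n lab) w (origin, 1) = (c, q) \<and> q \<in> {1..2*n}"
  using assms
proof (induction "\<Sum>i<n. nat \<bar>c i\<bar>" arbitrary: c rule: less_induct)
  case less
  show ?case
  proof (cases "c = origin")
    case True
    then show ?thesis using n by (intro exI[of _ "[]"]) auto
  next
    case False
    then obtain i where i: "c i \<noteq> 0" by (auto simp: origin_def)
    then have "i < n" using less.prems by (intro not_le_imp_less notI) (auto simp: cells_def)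
    define d where "d = c(i := c i - sgn (c i))"
    have adj: "adj n d c"
      unfolding adj_def by (rule exI[of _ i]) (use i \<open>i < n\<close> in \<open>auto simp: d_def abs_sgn_eq\<close>)
    then have d: "d \<in> cells n" using less.prems adj_in_cells adj_sym by blast
    have "(\<Sum>j<n. nat \<bar>d j\<bar>) < (\<Sum>j<n. nat \<bar>c j\<bar>)"
      by (rule sum_strict_mono_ex1) (use i \<open>i < n\<close> in \<open>auto simp: d_def sgn_if\<close>)
    from less.hyps[OF this d] obtain w q
      where w: "act_word (act n lab) w (origin, 1) = (d, q)" "q \<in> {1..2*n}" by blast
    obtain u q' where "act_word (act n lab) u (d, q) = (c, q')" "q' \<in> {1..2*n}"
      using act_word_adj[OF d w(2) adj] by blast
    then show ?thesis using w by (intro exI[of _ "w @ u"]) (auto simp: act_word_append)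
  qed
qed

end

section \<open>A fraction machine walking through all words\<close>

text \<open>The number holds three registers as the exponents of 2, 3 and 5. In round \<open>v\<close> the machine
  applies the generator given by the last nonzero base-5 digit of \<open>v\<close>: it copies \<open>v\<close> from the
  exponent of 2 to those of 3 and 5, divides the latter by 5 until a nonzero remainder shows up,
  and restores \<open>v + 1\<close> from the exponent of 3.\<close>

datatype ctl = Copy | Divide | Restore | Clear | Return

text \<open>The digits 1, 2 and the digits 3, 4 carry mutually inverse moves, as \<open>Tau\<close>
  is an involution. Two generators with their inverses need four nonzero digits, which is why the
  base is 5.\<close>

definition digit_move :: "nat \<Rightarrow> mv" where
  "digit_move r = (if r = 1 then Rho else if r = 2 then RhoInv else Tau)"

text \<open>A result \<open>(s, g, m, k)\<close> means: enter state \<open>s\<close>, move by \<open>g\<close>, multiply the number by \<open>k / m\<close>.\<close>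
fun instr :: "ctl \<Rightarrow> nat \<Rightarrow> ctl \<times> mv \<times> nat \<times> nat" where
  "instr Copy r = (if 2 dvd r then (Copy, Stay, 2, 15) else (Divide, Stay, 1, 1))"
| "instr Divide r =
    (if 5 ^ 5 dvd r then (Divide, Stay, 5 ^ 5, 2)
     else if 5 ^ 4 dvd r then (Clear, digit_move 4, 5 ^ 4, 1)
     else if 5 ^ 3 dvd r then (Clear, digit_move 3, 5 ^ 3, 1)
     else if 5 ^ 2 dvd r then (Clear, digit_move 2, 5 ^ 2, 1)
     else if 5 ^ 1 dvd r then (Clear, digit_move 1, 5 ^ 1, 1)
     else (Restore, Stay, 1, 1))"
| "instr Restore r = (if 2 dvd r then (Restore, Stay, 2, 5) else (Divide, Stay, 1, 1))"
| "instr Clear r = (if 2 dvd r then (Clear, Stay, 2, 1) else (Return, Stay, 1, 1))"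
| "instr Return r = (if 3 dvd r then (Return, Stay, 3, 2) else (Copy, Stay, 1, 2))"

text \<open>The least common multiple of the divisors tested by \<open>instr\<close>, so that the
  residue decides every branch.\<close>

definition modulus :: nat where
  "modulus = 2 * 3 * 5 ^ 5"

definition fstep :: "(mv \<Rightarrow> 'x \<Rightarrow> 'x) \<Rightarrow> ctl \<times> 'x \<times> nat \<Rightarrow> ctl \<times> 'x \<times> nat" where
  "fstep a = (\<lambda>(s, x, d). case instr s (d mod modulus) of (s', g, m, k) \<Rightarrow> (s', a g x, d div m * k))"

lemma dvd_modulus:
  "5 ^ 5 dvd d mod modulus \<longleftrightarrow> 5 ^ 5 dvd d" "5 ^ 4 dvd d mod modulus \<longleftrightarrow> 5 ^ 4 dvd d"
  "5 ^ 3 dvd d mod modulus \<longleftrightarrow> 5 ^ 3 dvd d" "5 ^ 2 dvd d mod modulus \<longleftrightarrow> 5 ^ 2 dvd d"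
  "5 ^ 1 dvd d mod modulus \<longleftrightarrow> 5 ^ 1 dvd d"
  "2 dvd d mod modulus \<longleftrightarrow> 2 dvd d" "3 dvd d mod modulus \<longleftrightarrow> 3 dvd d"
  by (rule dvd_mod_iff; simp add: modulus_def)+

text \<open>Every branch tests the factor that it removes, so division by \<open>m\<close> is exact.
  The values of \<open>k\<close> are 1, 2, 5 and 15; their least common multiple 30 determines the
  speeds of the synchronous agents.\<close>

lemma instr_cases:
  assumes "instr s (d mod modulus) = (s', g, m, k)"
  shows "m dvd d" "0 < m" "0 < k" "k dvd 30"
  using assms
  by (cases s; simp only: instr.simps dvd_modulus split: if_splits; auto)+

section \<open>Reachability and simulation\<close>

definition reaches :: "('c \<Rightarrow> 'c) \<Rightarrow> 'c \<Rightarrow> 'c \<Rightarrow> bool" where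
  "reaches f c c' \<longleftrightarrow> (\<exists>t. (f ^^ t) c = c')"

lemma reaches_refl [intro]: "reaches f c c"
  unfolding reaches_def by (rule exI[of _ 0]) simp

lemma reaches_step: "reaches f (f c) c' \<Longrightarrow> reaches f c c'"
  unfolding reaches_def by (metis comp_apply funpow_Suc_right)

lemma reaches_trans [trans]:
  assumes "reaches f c c'" "reaches f c' c''" shows "reaches f c c''"
proof -
  from assms obtain t t' where "(f ^^ t) c = c'" "(f ^^ t') c' = c''" by (auto simp: reaches_def)
  then have "(f ^^ (t' + t)) c = c''" by (simp add: funpow_add)
  then show ?thesis unfolding reaches_def by blast
qed

lemma reaches_Suc:
  assumes "reaches f c c'" "f c' = c''" shows "reaches f c c''"
  using reaches_trans[OF assms(1) reaches_step[of f c' "f c'"]] assms(2) by auto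

lemma reaches_simulation:
  assumes "reaches f c c'" "R c e" and step: "\<And>c e. R c e \<Longrightarrow> \<exists>e'. reaches g e e' \<and> R (f c) e'"
  shows "\<exists>e'. reaches g e e' \<and> R c' e'"
proof -
  from assms(1) obtain t where "(f ^^ t) c = c'" by (auto simp: reaches_def)
  moreover have "\<exists>e'. reaches g e e' \<and> R ((f ^^ t) c) e'"
  proof (induction t)
    case 0
    show ?case using assms(2) by auto
  next
    case (Suc t)
    then obtain e' where e': "reaches g e e'" "R ((f ^^ t) c) e'" by blast
    from step[OF e'(2)] obtain e'' where "reaches g e' e''" "R (f ((f ^^ t) c)) e''" by blast
    with reaches_trans[OF e'(1)] show ?case by auto
  qed
  ultimately show ?thesis by simp
qed

lemma five_not_dvd: "\<not> 5 dvd (2::nat) ^ t * 3 ^ u"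
proof -
  have "\<not> 5 dvd (3::nat) ^ u" by (induction u) (auto, presburger)
  then show ?thesis by (induction t) (auto simp: mult.assoc, presburger)
qed

lemma three_not_dvd: "\<not> 3 dvd (2::nat) ^ t"
  by (induction t) (auto, presburger)

lemma five_power_dvd: "5 ^ j dvd (2::nat) ^ t * 3 ^ u * 5 ^ r \<longleftrightarrow> j \<le> r"
proof
  assume *: "5 ^ j dvd (2::nat) ^ t * 3 ^ u * 5 ^ r"
  show "j \<le> r"
  proof (rule ccontr)
    assume "\<not> j \<le> r"
    then have "(5::nat) ^ Suc r dvd 5 ^ j" by (intro le_imp_power_dvd) simp
    then have "5 * 5 ^ r dvd (2::nat) ^ t * 3 ^ u * 5 ^ r" using * dvd_trans by fastforce
    then have "5 dvd (2::nat) ^ t * 3 ^ u" by (subst (asm) dvd_times_right_cancel_iff) auto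
    then show False using five_not_dvd by blast
  qed
next
  assume "j \<le> r"
  then show "5 ^ j dvd (2::nat) ^ t * 3 ^ u * 5 ^ r" by (intro dvd_mult le_imp_power_dvd)
qed

section \<open>Last nonzero base-5 digits\<close>

function gen :: "nat \<Rightarrow> mv" where
  "gen v = (if v = 0 then Stay else if v mod 5 \<noteq> 0 then digit_move (v mod 5) else gen (v div 5))"
  by auto
termination by (relation "measure id") auto

declare gen.simps [simp del]

lemma gen_mult_5: "0 < v \<Longrightarrow> gen (5 * v) = gen v"
  by (subst gen.simps) simp

lemma gen_digit: "0 < r \<Longrightarrow> r < 5 \<Longrightarrow> gen (5 * v + r) = digit_move r"
  by (subst gen.simps) simp

lemma gen_power: "0 < v \<Longrightarrow> gen (5 ^ N * v) = gen v"
  by (induction N) (auto simp: mult.assoc gen_mult_5)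

text \<open>One of the lowest \<open>N\<close> digits of \<open>i\<close> is nonzero and hides
  \<open>v\<close>. The self-similarity of the walk rests on this.\<close>

lemma gen_add_power:
  assumes "0 < i" "i < 5 ^ N" shows "gen (5 ^ N * v + i) = gen i"
  using assms
proof (induction N arbitrary: i)
  case (Suc N)
  have eq: "5 ^ Suc N * v + i = 5 * (5 ^ N * v + i div 5) + i mod 5" by simp
  show ?case
  proof (cases "i mod 5 = 0")
    case True
    then have "gen i = gen (i div 5)" using gen_mult_5[of "i div 5"] Suc.prems by auto
    moreover have "gen (5 ^ Suc N * v + i) = gen (5 ^ N * v + i div 5)"
      unfolding eq using True Suc.prems gen_mult_5[of "5 ^ N * v + i div 5"] by auto
    ultimately show ?thesis using Suc.IH[of "i div 5"] Suc.prems True by auto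
  next
    case False
    then have "gen (5 ^ Suc N * v + i) = digit_move (i mod 5)"
      by (subst eq) (rule gen_digit, auto)
    moreover have "gen i = digit_move (i mod 5)"
      using gen_digit[of "i mod 5" "i div 5"] False by simp
    ultimately show ?thesis by simp
  qed
qed simp

text \<open>All that the machine and both teams use of the grid: invertible moves without fixed
  points, apart from \<open>Stay\<close>, and a \<open>Pi\<close> orbit that never returns, so that
  a distance is determined by its two ends.\<close>

locale corner_space =
  fixes X :: "'x set" and act :: "mv \<Rightarrow> 'x \<Rightarrow> 'x"
  assumes act_in: "x \<in> X \<Longrightarrow> act m x \<in> X"
    and act_Stay: "x \<in> X \<Longrightarrow> act Stay x = x"
    and act_minv: "x \<in> X \<Longrightarrow> act (minv m) (act m x) = x"
    and act_neq: "x \<in> X \<Longrightarrow> m \<noteq> Stay \<Longrightarrow> act m x \<noteq> x"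
    and aperiodic: "x \<in> X \<Longrightarrow> 0 < z \<Longrightarrow> (act Pi ^^ z) x \<noteq> x"
begin

abbreviation line :: "'x \<Rightarrow> nat \<Rightarrow> 'x" where
  "line x i \<equiv> (act Pi ^^ i) x"

lemma line_in: "x \<in> X \<Longrightarrow> line x i \<in> X"
  by (induction i) (auto intro: act_in)

lemma line_eq_iff:
  assumes "x \<in> X" shows "line x i = line x j \<longleftrightarrow> i = j"
proof -
  have "line x i \<noteq> line x j" if "i < j" for i j
  proof -
    have "line x j = line (line x i) (j - i)"
      using that by (metis comp_apply funpow_add le_add_diff_inverse2 less_imp_le)
    then show ?thesis using aperiodic[OF line_in[OF assms], of "j - i" i] that by auto
  qed
  then show ?thesis by (metis linorder_neqE_nat)
qed

lemma line_eq_self_iff: "x \<in> X \<Longrightarrow> line x i = x \<longleftrightarrow> i = 0"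
  using line_eq_iff[of x i 0] by simp

lemma PiInv_line: "x \<in> X \<Longrightarrow> act PiInv (line x (Suc i)) = line x i"
  using act_minv[OF line_in, of x Pi i] by simp

section \<open>Correctness of the fraction machine\<close>

lemma reaches_Copy:
  assumes "x \<in> X"
  shows "reaches (fstep act) (Copy, x, 2 ^ t * 3 ^ u * 5 ^ v) (Divide, x, 3 ^ (u + t) * 5 ^ (v + t))"
proof (induction t arbitrary: u v)
  case 0
  show ?case by (rule reaches_step) (auto simp: fstep_def act_Stay[OF assms] dvd_modulus)
next
  case (Suc t)
  have "fstep act (Copy, x, 2 ^ Suc t * 3 ^ u * 5 ^ v) = (Copy, x, 2 ^ t * 3 ^ Suc u * 5 ^ Suc v)"
    by (simp add: fstep_def act_Stay[OF assms] dvd_modulus)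
  with Suc[of "Suc u" "Suc v"] show ?case by - (rule reaches_step, simp)
qed

text \<open>In \<open>5 ^ 5\<close> the basis names the register and the exponent is the base of the
  digits: each step takes 5 from the register and records it as one factor 2.\<close>

lemma reaches_Divide:
  assumes "x \<in> X" "r < 5"
  shows "reaches (fstep act) (Divide, x, 2 ^ t * 3 ^ u * 5 ^ (5 * q + r)) (Divide, x, 2 ^ (t + q) * 3 ^ u * 5 ^ r)"
proof (induction q arbitrary: t)
  case (Suc q)
  let ?d = "2 ^ t * 3 ^ u * 5 ^ (5 * Suc q + r) :: nat"
  have "?d = (2 ^ t * 3 ^ u * 5 ^ (5 * q + r)) * 5 ^ 5" by (simp add: power_add)
  then have div: "?d div 5 ^ 5 * 2 = 2 ^ Suc t * 3 ^ u * 5 ^ (5 * q + r)" by simp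
  have "fstep act (Divide, x, ?d) = (Divide, act Stay x, ?d div 5 ^ 5 * 2)"
    unfolding fstep_def prod.case instr.simps dvd_modulus five_power_dvd by simp
  then have "fstep act (Divide, x, ?d) = (Divide, x, 2 ^ Suc t * 3 ^ u * 5 ^ (5 * q + r))"
    unfolding div act_Stay[OF assms(1)] .
  with Suc[of "Suc t"] show ?case by (metis reaches_step add_Suc_shift)
qed auto

text \<open>Since the higher powers are tested first, the branch taken reveals the remainder
  exactly.\<close>

lemma fstep_Divide:
  assumes "0 < r" "r < 5"
  shows "fstep act (Divide, x, 2 ^ t * 3 ^ u * 5 ^ r) = (Clear, act (digit_move r) x, 2 ^ t * 3 ^ u)"
proof -
  have "r = 1 \<or> r = 2 \<or> r = 3 \<or> r = 4" using assms by auto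
  then show ?thesis
    unfolding fstep_def prod.case instr.simps
    by (elim disjE) (simp_all only: dvd_modulus five_power_dvd, simp_all)
qed

lemma reaches_Restore:
  assumes "x \<in> X"
  shows "reaches (fstep act) (Restore, x, 2 ^ t * 3 ^ u * 5 ^ v) (Divide, x, 3 ^ u * 5 ^ (v + t))"
proof (induction t arbitrary: v)
  case 0
  show ?case by (rule reaches_step) (auto simp: fstep_def act_Stay[OF assms] dvd_modulus)
next
  case (Suc t)
  have "fstep act (Restore, x, 2 ^ Suc t * 3 ^ u * 5 ^ v) = (Restore, x, 2 ^ t * 3 ^ u * 5 ^ Suc v)"
    by (simp add: fstep_def act_Stay[OF assms] dvd_modulus)
  with Suc[of "Suc v"] show ?case by - (rule reaches_step, simp)
qed

lemma reaches_Clear: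
  assumes "x \<in> X"
  shows "reaches (fstep act) (Clear, x, 2 ^ t * 3 ^ u) (Return, x, 3 ^ u)"
proof (induction t)
  case 0
  show ?case by (rule reaches_step) (auto simp: fstep_def act_Stay[OF assms] dvd_modulus)
next
  case (Suc t)
  have "fstep act (Clear, x, 2 ^ Suc t * 3 ^ u) = (Clear, x, 2 ^ t * 3 ^ u)"
    by (simp add: fstep_def act_Stay[OF assms] dvd_modulus)
  with Suc show ?case by - (rule reaches_step, simp)
qed

lemma reaches_Return:
  assumes "x \<in> X"
  shows "reaches (fstep act) (Return, x, 2 ^ t * 3 ^ u) (Copy, x, 2 ^ Suc (t + u))"
proof (induction u arbitrary: t)
  case 0
  show ?case
    by (rule reaches_step) (auto simp: fstep_def act_Stay[OF assms] dvd_modulus three_not_dvd mult.commute)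
next
  case (Suc u)
  have "fstep act (Return, x, 2 ^ t * 3 ^ Suc u) = (Return, x, 2 ^ Suc t * 3 ^ u)"
    by (simp add: fstep_def act_Stay[OF assms] dvd_modulus)
  with Suc[of "Suc t"] show ?case by - (rule reaches_step, simp)
qed

text \<open>A remainder 0 only replaces \<open>v\<close> by \<open>v div 5\<close>, which has the
  same last nonzero digit. The exponent of 3 is untouched meanwhile and survives as the round
  number, which \<open>Return\<close> increments.\<close>

lemma reaches_gen:
  assumes x: "x \<in> X" and v: "0 < v"
  shows "reaches (fstep act) (Divide, x, 3 ^ u * 5 ^ v) (Copy, act (gen v) x, 2 ^ Suc u)"
  using v
proof (induction v rule: less_induct)
  case (less v)
  define q r where "q = v div 5" and "r = v mod 5"
  have v: "v = 5 * q + r" and r: "r < 5" by (auto simp: q_def r_def)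
  have div: "reaches (fstep act) (Divide, x, 3 ^ u * 5 ^ v) (Divide, x, 2 ^ q * 3 ^ u * 5 ^ r)"
    using reaches_Divide[OF x r, of 0 u q] v by simp
  show ?case
  proof (cases "r = 0")
    case True
    then have "0 < q" "q < v" using v less.prems by auto
    have "fstep act (Divide, x, 2 ^ q * 3 ^ u * 5 ^ 0) = (Restore, x, 2 ^ q * 3 ^ u * 5 ^ 0)"
      unfolding fstep_def prod.case instr.simps
      by (simp only: dvd_modulus five_power_dvd) (simp add: act_Stay[OF x])
    with reaches_Restore[OF x, of q u 0]
    have "reaches (fstep act) (Divide, x, 2 ^ q * 3 ^ u * 5 ^ r) (Divide, x, 3 ^ u * 5 ^ q)"
      unfolding True by - (rule reaches_step, simp)
    also have "reaches (fstep act) \<dots> (Copy, act (gen q) x, 2 ^ Suc u)"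
      using less.IH \<open>0 < q\<close> \<open>q < v\<close> by blast
    also have "gen q = gen v" using gen_mult_5[OF \<open>0 < q\<close>] v True by simp
    finally show ?thesis by (rule reaches_trans[OF div])
  next
    case False
    define y where "y = act (digit_move r) x"
    have y: "y \<in> X" using act_in[OF x] by (simp add: y_def)
    note div
    also have "reaches (fstep act) (Divide, x, 2 ^ q * 3 ^ u * 5 ^ r) (Clear, y, 2 ^ q * 3 ^ u)"
      using fstep_Divide[of r x q u] False r by - (rule reaches_step, auto simp: y_def)
    also have "reaches (fstep act) \<dots> (Return, y, 2 ^ 0 * 3 ^ u)"
      using reaches_Clear[OF y] by simp
    also have "reaches (fstep act) \<dots> (Copy, y, 2 ^ Suc (0 + u))" using reaches_Return[OF y] .
    also have "y = act (gen v) x" using gen_digit[of r q] False r v by (simp add: y_def)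
    finally show ?thesis by simp
  qed
qed

section \<open>The self-similar walk through all words\<close>

primrec orbit :: "'x \<Rightarrow> nat \<Rightarrow> 'x" where
  "orbit x 0 = x"
| "orbit x (Suc v) = act (gen (Suc v)) (orbit x v)"

lemma orbit_in: "x \<in> X \<Longrightarrow> orbit x v \<in> X"
  by (induction v) (auto intro: act_in)

text \<open>Starting in \<open>Return\<close> increments the empty counter before the first round,
  so round 0, which has no nonzero digit, never occurs. The exponent is one ahead of the rounds
  completed.\<close>

lemma reaches_orbit:
  assumes x: "x \<in> X"
  shows "reaches (fstep act) (Return, x, 1) (Copy, orbit x v, 2 ^ Suc v)"
proof (induction v)
  case 0
  show ?case using reaches_Return[OF x, of 0 0] by simp
next
  case (Suc v)
  note Suc
  also have "reaches (fstep act) (Copy, orbit x v, 2 ^ Suc v) (Divide, orbit x v, 3 ^ Suc v * 5 ^ Suc v)"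
    using reaches_Copy[OF orbit_in[OF x], of v "Suc v" 0 0] by simp
  also have "reaches (fstep act) \<dots> (Copy, orbit x (Suc v), 2 ^ Suc (Suc v))"
    using reaches_gen[OF orbit_in[OF x], of "Suc v" v "Suc v"] by simp
  finally show ?case .
qed

lemma orbit_shift:
  "i < 5 ^ N \<Longrightarrow> orbit x (5 ^ N * v + i) = orbit (orbit x (5 ^ N * v)) i"
  by (induction i) (use gen_add_power[of "Suc _" N v] in auto)

text \<open>The five blocks of \<open>5 ^ N\<close> rounds are joined by Rho, RhoInv, Tau, Tau, so that a block
  returns to its start if the shorter blocks do.\<close>
lemma orbit_words:
  assumes "x \<in> X"
  shows "orbit x (5 ^ N - 1) = x \<and> (\<forall>w. length w \<le> N \<longrightarrow> (\<exists>i<5 ^ N. orbit x i = act_word act w x))"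
  using assms
proof (induction N arbitrary: x)
  case 0
  show ?case by simp
next
  case (Suc N)
  \<comment> \<open>Block \<open>v - 1\<close> has come home by its last round, so round
    \<open>5 ^ N * v\<close>, whose last nonzero digit is \<open>v\<close>, acts on the point where
    that block began.\<close>
  have cross: "orbit x (5 ^ N * v) = act (digit_move v) (orbit x (5 ^ N * (v - 1)))" if v: "0 < v" "v < 5" for v
  proof -
    have "5 ^ N * v = Suc (5 ^ N * (v - 1) + (5 ^ N - 1))" using v by (cases v) auto
    moreover have "orbit x (5 ^ N * (v - 1) + (5 ^ N - 1)) = orbit x (5 ^ N * (v - 1))"
      by (subst orbit_shift) (use Suc.IH orbit_in[OF Suc.prems] in auto)
    moreover have "gen (5 ^ N * v) = digit_move v"
      using v gen_power[of v N] gen_digit[of v 0] by simp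
    ultimately show ?thesis by (metis orbit.simps(2))
  qed
  have c: "orbit x (5 ^ N * 1) = act Rho x" "orbit x (5 ^ N * 2) = x"
    "orbit x (5 ^ N * 3) = act Tau x" "orbit x (5 ^ N * 4) = x"
    using cross[of 1] cross[of 2] cross[of 3] cross[of 4] act_minv[OF Suc.prems, of Rho]
      act_minv[OF Suc.prems, of Tau]
    by (simp_all add: digit_move_def)
  have "orbit x (5 ^ Suc N - 1) = orbit x (5 ^ N * 4 + (5 ^ N - 1))" by (simp add: algebra_simps)
  also have "\<dots> = orbit (orbit x (5 ^ N * 4)) (5 ^ N - 1)" by (rule orbit_shift) simp
  also have "\<dots> = x" using Suc.IH[OF Suc.prems] by (simp only: c)
  finally have ret: "orbit x (5 ^ Suc N - 1) = x" .
  have "\<exists>i<5 ^ Suc N. orbit x i = act_word act w x" if w: "length w \<le> Suc N" for w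
  proof (cases w)
    case Nil
    then show ?thesis by (intro exI[of _ 0]) simp
  next
    case (Cons b w')
    \<comment> \<open>Blocks 1 and 3 begin at \<open>act Rho x\<close> and \<open>act Tau x\<close>;
      the one selected by the first letter contains the rest of the word.\<close>
    define v where "v = (if b then 3 else 1 :: nat)"
    define y where "y = act (if b then Tau else Rho) x"
    have "y \<in> X" using act_in Suc.prems by (simp add: y_def)
    then obtain i where i: "i < 5 ^ N" "orbit y i = act_word act w' y"
      using Suc.IH[of y] w Cons by auto
    have "y = orbit x (5 ^ N * v)" using c by (simp add: v_def y_def)
    then have "orbit x (5 ^ N * v + i) = act_word act w x"
      using orbit_shift[OF i(1), of x v] i(2) Cons by (simp add: y_def)
    moreover have "5 ^ N * v + i < 5 ^ Suc N" using i(1) by (auto simp: v_def)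
    ultimately show ?thesis by blast
  qed
  with ret show ?case by blast
qed

lemma fstep_in:
  assumes "x \<in> X" "0 < d" "fstep act (s, x, d) = (s', x', d')"
  shows "x' \<in> X" "0 < d'"
proof -
  obtain r g m k where i: "instr s (d mod modulus) = (r, g, m, k)" by (metis prod_cases4)
  show "x' \<in> X" "0 < d'"
    using assms instr_cases[OF i] act_in by (auto simp: fstep_def i dvd_div_eq_0_iff)
qed

lemma reaches_word:
  assumes "x \<in> X"
  shows "\<exists>s d. reaches (fstep act) (Return, x, 1) (s, act_word act w x, d)"
proof -
  obtain i where "orbit x i = act_word act w x"
    using orbit_words[OF assms, of "length w"] by blast
  with reaches_orbit[OF assms, of i] show ?thesis by auto
qed

end

sublocale grid \<subseteq> corner_space "corners n" "act n lab"
  using act_in act_minv act_neq tour_aperiodic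
  by unfold_locales (auto simp: act_simps)

section \<open>Three synchronous agents\<close>

text \<open>The number \<open>d\<close> at base \<open>x\<close> is represented by a marker at \<open>x\<close> and two agents at distance \<open>d\<close>
  on the tour through \<open>x\<close>. One of them runs to the marker at full speed, so that it knows
  \<open>d mod modulus\<close> there, and continues on the tour through the new base with speed \<open>1 / (e + 1)\<close>.
  The other one runs to the marker with speed \<open>1 / 31\<close> and then chases the first one at full
  speed. They meet at distance \<open>30 * d / e\<close>, which is \<open>d / m * k\<close> for \<open>e = 30 / k * m\<close>.\<close>

datatype sstate = Marker | Told mv | SlowStart | Slow nat | Chase
  | FastStart | Fast ctl nat | Lead ctl nat nat

text \<open>Marker and fast agent see each other in the same step and evaluate \<open>instr\<close>
  at the same residue. Only one agent can be in a \<open>Fast\<close> or \<open>Told\<close> state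
  during the runs considered, so \<open>SOME\<close> leaves no choice.\<close>

fun sync_rule :: "sstate cautomaton" where
  "sync_rule Marker V =
    (if \<exists>s r. Fast s r \<in> V
     then (Told (SOME g. \<exists>s r. Fast s r \<in> V \<and> g = fst (snd (instr s r))), Stay) else (Marker, Stay))"
| "sync_rule (Told g) V = (if Slow 0 \<in> V then (Marker, g) else (Told g, Stay))"
| "sync_rule SlowStart V = (Slow 0, Pi)"
| "sync_rule (Slow j) V =
    (if \<exists>g. Told g \<in> V then (Chase, SOME g. Told g \<in> V)
     else if j = 30 then (Slow 0, PiInv) else (Slow (Suc j), Stay))"
| "sync_rule Chase V = (if \<exists>s e j. Lead s e j \<in> V then (Slow 0, Stay) else (Chase, Pi))"
| "sync_rule FastStart V = (Fast Return 0, Pi)"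
| "sync_rule (Fast s r) V =
    (if Marker \<in> V then (case instr s r of (s', g, m, k) \<Rightarrow> (Lead s' (30 div k * m) 0, g))
     else (Fast s (Suc r mod modulus), PiInv))"
| "sync_rule (Lead s e j) V =
    (if Chase \<in> V then (Fast s 0, Stay)
     else (Lead s e (if j = e then 0 else Suc j), if j = 0 then Pi else Stay))"

definition sync_states :: "sstate set" where
  "sync_states = {Marker, SlowStart, Chase, FastStart} \<union> range Told \<union> Slow ` {..30}
    \<union> (\<Union>s. Fast s ` {..<modulus}) \<union> (\<Union>s. \<Union>e\<le>30 * 5 ^ 5. Lead s e ` {..e})"

lemma sync_states_iff [simp]:
  "Marker \<in> sync_states" "SlowStart \<in> sync_states" "Chase \<in> sync_states"
  "FastStart \<in> sync_states" "Told g \<in> sync_states"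
  "Slow j \<in> sync_states \<longleftrightarrow> j \<le> 30" "Fast s r \<in> sync_states \<longleftrightarrow> r < modulus"
  "Lead s e j \<in> sync_states \<longleftrightarrow> e \<le> 30 * 5 ^ 5 \<and> j \<le> e"
  by (auto simp: sync_states_def image_iff)

lemma finite_ctl: "finite (UNIV :: ctl set)"
proof -
  have "(UNIV :: ctl set) \<subseteq> {Copy, Divide, Restore, Clear, Return}" using ctl.exhaust by blast
  then show ?thesis using finite_subset by blast
qed

lemma finite_mv: "finite (UNIV :: mv set)"
proof -
  have "(UNIV :: mv set) \<subseteq> {Stay, Pi, PiInv, Rho, RhoInv, Tau}" using mv.exhaust by blast
  then show ?thesis using finite_subset by blast
qed

lemma finite_sync_states: "finite sync_states"
  unfolding sync_states_def using finite_ctl finite_mv by auto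

lemma instr_bound: "instr s r = (s', g, m, k) \<Longrightarrow> m \<le> 5 ^ 5 \<and> k \<le> 15"
  by (cases s) (auto split: if_splits)

lemma modulus_pos: "0 < modulus"
  by (simp add: modulus_def)

lemma sync_rule_closed:
  assumes "q \<in> sync_states" shows "fst (sync_rule q V) \<in> sync_states"
proof (cases q)
  case (Fast s r)
  obtain s' g m k where i: "instr s r = (s', g, m, k)" by (metis prod_cases4)
  have "30 div k * m \<le> 30 * 5 ^ 5" using instr_bound[OF i] by (intro mult_le_mono) auto
  with i show ?thesis using Fast modulus_pos by auto
qed (use assms modulus_pos in auto)

section \<open>Timing of the meetings\<close>

context corner_space begin

definition sync_agent :: "('x \<times> sstate) set \<Rightarrow> 'x \<times> sstate \<Rightarrow> 'x \<times> sstate" where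
  "sync_agent G = (\<lambda>(x, q). let r = sync_rule q {q'. (x, q') \<in> G} in (act (snd r) x, fst r))"

definition sync_step where
  "sync_step = (\<lambda>(a, b, c). let G = {a, b, c} in (sync_agent G a, sync_agent G b, sync_agent G c))"

definition sync_conf where
  "sync_conf = (\<lambda>(s, x, d). ((x, Marker), (line x d, Slow 0), (line x d, Fast s 0)))"

definition slow where
  "slow x d t = (line x (d - t div 31), Slow (t mod 31))"

text \<open>The position is the ceiling of \<open>t / (e + 1)\<close>: the counter starts at 0, and
  that is when the agent steps, so it moves first and waits afterwards.\<close>

definition lead where
  "lead s x e t = (line x ((t + e) div Suc e), Lead s e (t mod Suc e))"

lemma slow_step:
  assumes x: "x \<in> X" and t: "t < 31 * d" and G: "\<And>g. (line x (d - t div 31), Told g) \<notin> G"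
  shows "sync_agent G (slow x d t) = slow x d (Suc t)"
proof (cases "t mod 31 = 30")
  case True
  have "t div 31 < d" using t by (simp add: less_mult_imp_div_less mult.commute)
  moreover have "Suc t div 31 = Suc (t div 31)" "Suc t mod 31 = 0"
    using True by (simp_all add: div_Suc mod_Suc)
  ultimately have pos: "d - t div 31 = Suc (d - Suc t div 31)" "Suc t mod 31 = 0" by auto
  define i where "i = d - Suc t div 31"
  have "slow x d t = (line x (Suc i), Slow 30)" "slow x d (Suc t) = (line x i, Slow 0)"
    unfolding slow_def pos True i_def by simp_all
  moreover have "(line x (Suc i), Told g) \<notin> G" for g
    using G unfolding pos(1) i_def .
  ultimately show ?thesis
    using PiInv_line[OF x, of i] by (simp add: sync_agent_def del: funpow.simps)
next
  case False
  then show ?thesis using G act_Stay[OF line_in[OF x]]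
    by (simp add: sync_agent_def slow_def mod_Suc div_Suc)
qed

lemma ceil_div: "((t::nat) + e) div Suc e = t div Suc e + (if t mod Suc e = 0 then 0 else 1)"
proof -
  define q r where "q = t div Suc e" and "r = t mod Suc e"
  have t: "t = q * Suc e + r" and r: "r < Suc e" unfolding q_def r_def by (simp_all only: div_mult_mod_eq mod_less_divisor zero_less_Suc)
  have "(t + e) div Suc e = q + (r + e) div Suc e" unfolding t
    by (simp only: add.assoc) (simp only: div_mult_self3 nat.distinct simp_thms)
  also have "(r + e) div Suc e = (if r = 0 then 0 else 1)"
    using r by (auto intro: div_nat_eqI)
  finally show ?thesis by (simp add: q_def r_def)
qed

lemma lead_step:
  assumes x: "x \<in> X" and G: "(line x ((t + e) div Suc e), Chase) \<notin> G"
  shows "sync_agent G (lead s x e t) = lead s x e (Suc t)"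
proof -
  have "(Suc t + e) div Suc e = Suc (t div Suc e)"
    unfolding add_Suc_shift by (simp only: div_add_self2 nat.distinct not_False_eq_True Suc_eq_plus1[symmetric])
  moreover have "t mod Suc e = e \<longleftrightarrow> Suc (t mod Suc e) = Suc e" by simp
  ultimately show ?thesis
    using G ceil_div[of t e]
    by (simp add: sync_agent_def lead_def mod_Suc act_Stay act_in line_in x)
qed

lemma sync_fast:
  assumes x: "x \<in> X" and "t \<le> d"
  shows "reaches sync_step (sync_conf (s, x, d))
    ((x, Marker), slow x d t, (line x (d - t), Fast s (t mod modulus)))"
  using assms(2)
proof (induction t)
  case 0
  show ?case by (auto simp: sync_conf_def slow_def)
next
  case (Suc t)
  have d: "d - t = Suc (d - Suc t)" using Suc.prems by auto
  define G where "G = {(x, Marker), slow x d t, (line x (d - t), Fast s (t mod modulus))}"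
  have "line x (d - t) \<noteq> x" using Suc.prems line_eq_self_iff[OF x] by auto
  then have "sync_agent G (x, Marker) = (x, Marker)"
    using act_Stay[OF x] by (auto simp: G_def slow_def sync_agent_def)
  moreover have "sync_agent G (slow x d t) = slow x d (Suc t)"
    by (rule slow_step[OF x]) (use Suc.prems in \<open>auto simp: G_def slow_def\<close>)
  moreover have "sync_agent G (line x (d - t), Fast s (t mod modulus)) =
      (line x (d - Suc t), Fast s (Suc t mod modulus))"
    using \<open>line x (d - t) \<noteq> x\<close> PiInv_line[OF x, of "d - Suc t"]
    by (auto simp: G_def slow_def sync_agent_def d mod_Suc_eq simp del: funpow.simps)
  ultimately have "sync_step ((x, Marker), slow x d t, (line x (d - t), Fast s (t mod modulus))) =
      ((x, Marker), slow x d (Suc t), (line x (d - Suc t), Fast s (Suc t mod modulus)))"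
    unfolding sync_step_def Let_def prod.case G_def[symmetric] by simp
  with Suc show ?case by (intro reaches_Suc[OF Suc.IH]) simp_all
qed

lemma sync_told:
  assumes x: "x \<in> X" and "0 < d" and i: "instr s (d mod modulus) = (s', g, m, k)" and e: "e = 30 div k * m"
  shows "sync_step ((x, Marker), slow x d d, (line x (d - d), Fast s (d mod modulus))) =
    ((x, Told g), slow x d (Suc d), lead s' (act g x) e 0)"
proof -
  define G where "G = {(x, Marker), slow x d d, (x, Fast s (d mod modulus))}"
  have "sync_agent G (x, Marker) = (x, Told g)"
    using act_Stay[OF x] i by (auto simp: G_def slow_def sync_agent_def)
  moreover have "sync_agent G (slow x d d) = slow x d (Suc d)"
    by (rule slow_step[OF x]) (use \<open>0 < d\<close> in \<open>auto simp: G_def slow_def\<close>)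
  moreover have "sync_agent G (x, Fast s (d mod modulus)) = lead s' (act g x) e 0"
    using i e by (auto simp: G_def sync_agent_def lead_def)
  ultimately show ?thesis unfolding diff_self_eq_0 funpow_0 sync_step_def Let_def prod.case G_def[symmetric] by simp
qed

text \<open>The tour through \<open>y\<close> may lead over \<open>x\<close> or over the slow agent.
  Such encounters are harmless: \<open>Lead\<close> reacts only to \<open>Chase\<close>,
  \<open>Slow\<close> only to \<open>Told\<close>, and \<open>Told\<close> only to
  \<open>Slow 0\<close>.\<close>

lemma sync_wait:
  assumes x: "x \<in> X" and y: "y \<in> X" and "Suc d + t \<le> 31 * d"
  shows "reaches sync_step ((x, Told g), slow x d (Suc d), lead s y e 0)
    ((x, Told g), slow x d (Suc d + t), lead s y e t)"
  using assms(3)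
proof (induction t)
  case 0
  show ?case by auto
next
  case (Suc t)
  define G where "G = {(x, Told g), slow x d (Suc d + t), lead s y e t}"
  have "(Suc d + t) div 31 < d" using Suc.prems by (simp add: less_mult_imp_div_less mult.commute)
  then have "line x (d - (Suc d + t) div 31) \<noteq> x" using line_eq_self_iff[OF x] by auto
  then have "sync_agent G (x, Told g) = (x, Told g)"
    using act_Stay[OF x] by (auto simp: G_def slow_def lead_def sync_agent_def)
  moreover have "sync_agent G (slow x d (Suc d + t)) = slow x d (Suc (Suc d + t))"
    by (rule slow_step[OF x])
      (use Suc.prems \<open>line x (d - (Suc d + t) div 31) \<noteq> x\<close> in \<open>auto simp: G_def slow_def lead_def\<close>)
  moreover have "sync_agent G (lead s y e t) = lead s y e (Suc t)"
    by (rule lead_step[OF y]) (auto simp: G_def slow_def lead_def)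
  ultimately have "sync_step ((x, Told g), slow x d (Suc d + t), lead s y e t) =
      ((x, Told g), slow x d (Suc d + Suc t), lead s y e (Suc t))"
    unfolding sync_step_def Let_def prod.case G_def[symmetric] by simp
  with Suc show ?case by (intro reaches_Suc[OF Suc.IH]) simp_all
qed

lemma sync_turn:
  assumes x: "x \<in> X" and y: "act g x \<in> X"
  shows "sync_step ((x, Told g), slow x d (31 * d), lead s (act g x) e t) =
    ((act g x, Marker), (line (act g x) 0, Chase), lead s (act g x) e (Suc t))"
proof -
  define G where "G = {(x, Told g), (x, Slow 0), lead s (act g x) e t}"
  have slow: "slow x d (31 * d) = (x, Slow 0)" by (simp add: slow_def)
  have "sync_agent G (x, Told g) = (act g x, Marker)" by (simp add: G_def sync_agent_def)
  moreover have "sync_agent G (x, Slow 0) = (line (act g x) 0, Chase)"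
    by (auto simp: G_def sync_agent_def lead_def)
  moreover have "sync_agent G (lead s (act g x) e t) = lead s (act g x) e (Suc t)"
    by (rule lead_step[OF y]) (auto simp: G_def lead_def)
  ultimately show ?thesis unfolding slow sync_step_def Let_def prod.case G_def[symmetric] by simp
qed

lemma sync_chase:
  assumes y: "y \<in> X" and d: "30 * d = e * d'" and e: "0 < e" and "t \<le> d'"
  shows "reaches sync_step ((y, Marker), (line y 0, Chase), lead s y e (30 * d))
    ((y, Marker), (line y t, Chase), lead s y e (30 * d + t))"
  using assms(4)
proof (induction t)
  case 0
  show ?case by auto
next
  case (Suc t)
  define G where "G = {(y, Marker), (line y t, Chase), lead s y e (30 * d + t)}"
  \<comment> \<open>Multiplied out, this says that the ceiling is at least \<open>Suc t\<close>:
    before \<open>d'\<close> the lead is strictly ahead of the chaser.\<close>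
  have "Suc e * Suc t \<le> e * d' + t + e"
    using Suc.prems mult_le_mono2[of "Suc t" d' e] e by simp
  then have "Suc t \<le> (30 * d + t + e) div Suc e"
    unfolding d by (simp only: less_eq_div_iff_mult_less_eq zero_less_Suc mult.commute)
  then have apart: "line y ((30 * d + t + e) div Suc e) \<noteq> line y t"
    using line_eq_iff[OF y] by simp
  have "sync_agent G (y, Marker) = (y, Marker)"
    using act_Stay[OF y] by (auto simp: G_def lead_def sync_agent_def)
  moreover have "sync_agent G (line y t, Chase) = (line y (Suc t), Chase)"
    using apart by (auto simp: G_def lead_def sync_agent_def)
  moreover have "sync_agent G (lead s y e (30 * d + t)) = lead s y e (Suc (30 * d + t))"
    by (rule lead_step[OF y]) (use apart in \<open>auto simp: G_def lead_def\<close>)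
  ultimately have "sync_step ((y, Marker), (line y t, Chase), lead s y e (30 * d + t)) =
      ((y, Marker), (line y (Suc t), Chase), lead s y e (30 * d + Suc t))"
    unfolding sync_step_def Let_def prod.case G_def[symmetric] by simp
  with Suc show ?case by (intro reaches_Suc[OF Suc.IH]) simp_all
qed

lemma sync_meet:
  assumes y: "y \<in> X" and d: "30 * d = e * d'"
  shows "sync_step ((y, Marker), (line y d', Chase), lead s y e (30 * d + d')) = sync_conf (s, y, d')"
proof -
  \<comment> \<open>The age is \<open>(e + 1) * d'\<close>, a multiple of the period, so the ceiling
    is exact.\<close>
  have "(30 * d + d' + e) div Suc e = d'" unfolding d by (intro div_nat_eqI) auto
  then have lead: "lead s y e (30 * d + d') = (line y d', Lead s e ((30 * d + d') mod Suc e))"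
    by (simp add: lead_def)
  show ?thesis
    unfolding sync_step_def sync_conf_def Let_def prod.case lead sync_agent_def
    using act_Stay[OF y] act_Stay[OF line_in[OF y]] by auto
qed

lemma sync_fstep:
  assumes x: "x \<in> X" and d: "0 < d"
  shows "reaches sync_step (sync_conf (s, x, d)) (sync_conf (fstep act (s, x, d)))"
proof -
  obtain s' g m k where i: "instr s (d mod modulus) = (s', g, m, k)" by (metis prod_cases4)
  note dvd = instr_cases[OF i]
  define e where "e = 30 div k * m"
  define d' where "d' = d div m * k"
  define y where "y = act g x"
  have y: "y \<in> X" using act_in[OF x] by (simp add: y_def)
  have "e * d' = (30 div k * k) * (d div m * m)" by (simp add: e_def d'_def)
  then have ed: "30 * d = e * d'" using dvd by simp
  then have e: "0 < e" using d by (cases e) auto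
  have "reaches sync_step (sync_conf (s, x, d))
      ((x, Marker), slow x d d, (line x (d - d), Fast s (d mod modulus)))"
    by (rule sync_fast[OF x order_refl])
  also have "reaches sync_step \<dots> ((x, Told g), slow x d (Suc d), lead s' y e 0)"
    unfolding y_def using sync_told[OF x d i e_def] by (rule reaches_Suc[OF reaches_refl])
  \<comment> \<open>The lead starts at time \<open>d + 1\<close> and the slow agent arrives at time
    \<open>31 * d\<close>. With the step that moves the marker, the lead has age
    \<open>30 * d\<close> when the chase begins.\<close>
  also have "reaches sync_step \<dots> ((x, Told g), slow x d (Suc d + (30 * d - 1)), lead s' y e (30 * d - 1))"
    by (rule sync_wait[OF x y]) (use d in auto)
  also have "Suc d + (30 * d - 1) = 31 * d" using d by simp
  also have "reaches sync_step ((x, Told g), slow x d (31 * d), lead s' y e (30 * d - 1))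
      ((y, Marker), (line y 0, Chase), lead s' y e (30 * d))"
    using sync_turn[OF x act_in[OF x], of g d s' e "30 * d - 1"] d
    by (intro reaches_Suc[OF reaches_refl]) (simp add: y_def)
  also have "reaches sync_step \<dots> ((y, Marker), (line y d', Chase), lead s' y e (30 * d + d'))"
    by (rule sync_chase[OF y ed e order_refl])
  also have "reaches sync_step \<dots> (sync_conf (s', y, d'))"
    using sync_meet[OF y ed] by (rule reaches_Suc[OF reaches_refl])
  also have "(s', y, d') = fstep act (s, x, d)"
    by (simp add: fstep_def i y_def d'_def)
  finally show ?thesis .
qed

lemma sync_word:
  assumes x: "x \<in> X"
  shows "\<exists>t. fst (fst ((sync_step ^^ t) ((x, Marker), (x, SlowStart), (x, FastStart)))) = act_word act w x"
proof -
  define R where "R = (\<lambda>(s, x, d) e. x \<in> X \<and> 0 < d \<and> e = sync_conf (s, x, d))"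
  obtain s d where "reaches (fstep act) (Return, x, 1) (s, act_word act w x, d)"
    using reaches_word[OF x] by blast
  then have "\<exists>e. reaches sync_step (sync_conf (Return, x, 1)) e \<and> R (s, act_word act w x, d) e"
  proof (rule reaches_simulation)
    show "R (Return, x, 1) (sync_conf (Return, x, 1))" using x by (simp add: R_def)
    fix c e assume "R c e"
    then obtain s x d where c: "c = (s, x, d)" "x \<in> X" "0 < d" "e = sync_conf (s, x, d)"
      by (cases c) (auto simp: R_def)
    obtain s' x' d' where f: "fstep act (s, x, d) = (s', x', d')" by (metis prod_cases3)
    show "\<exists>e'. reaches sync_step e e' \<and> R (fstep act c) e'"
      using sync_fstep[OF c(2,3), of s] fstep_in[OF c(2,3) f]
      by (intro exI[of _ "sync_conf (s', x', d')"]) (simp add: c(1,4) f R_def)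
  qed
  then obtain e where "reaches sync_step (sync_conf (Return, x, 1)) e" "R (s, act_word act w x, d) e"
    by blast
  then have "reaches sync_step (sync_conf (Return, x, 1)) (sync_conf (s, act_word act w x, d))"
    by (simp add: R_def)
  \<comment> \<open>All agents start at one corner, but the number 1 needs distance 1; the two start
    states exist for this single step.\<close>
  moreover have "sync_step ((x, Marker), (x, SlowStart), (x, FastStart)) = sync_conf (Return, x, 1)"
    using act_Stay[OF x] by (simp add: sync_step_def sync_agent_def sync_conf_def)
  ultimately have "reaches sync_step ((x, Marker), (x, SlowStart), (x, FastStart))
      (sync_conf (s, act_word act w x, d))" by (metis reaches_step)
  then obtain t where "(sync_step ^^ t) ((x, Marker), (x, SlowStart), (x, FastStart)) =
      sync_conf (s, act_word act w x, d)" by (auto simp: reaches_def)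
  then show ?thesis by (intro exI[of _ t]) (simp add: sync_conf_def)
qed

end

section \<open>Transfer to the grid: three agents\<close>

lemma sync_explorable_3:
  assumes n: "1 \<le> n" shows "sync_explorable n 3"
proof -
  define q0 :: "nat \<Rightarrow> sstate" where
    "q0 = (\<lambda>i. if i = 0 then Marker else if i = 1 then SlowStart else FastStart)"
  have q0: "q0 i \<in> sync_states" for i by (auto simp: q0_def sync_states_def)
  have "\<exists>Q \<delta> init. is_automaton n Q \<delta> \<and> (\<forall>i<3. init i \<in> Q) \<and>
    (\<forall>lab sched t i. valid_labelling n lab \<longrightarrow> no_port_cycle n lab \<longrightarrow> i < 3 \<longrightarrow>
      fst (run n lab \<delta> 3 init sched t) i =
      fst (fst (crun (act n lab) sync_rule 3 (\<lambda>_. (origin, 1), q0) sched t) i))"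
    by (rule corner_automaton_implementable[OF n finite_sync_states sync_rule_closed q0])
  then obtain Q \<delta> init where aut: "is_automaton n Q \<delta>" "\<forall>i<3. init i \<in> Q"
    and sim: "\<forall>lab sched t i. valid_labelling n lab \<longrightarrow> no_port_cycle n lab \<longrightarrow> i < 3 \<longrightarrow>
      fst (run n lab \<delta> 3 init sched t) i =
      fst (fst (crun (act n lab) sync_rule 3 (\<lambda>_. (origin, 1), q0) sched t) i)" by blast
  have "explored n lab \<delta> 3 init (sync_schedule 3)"
    if lab: "valid_labelling n lab" "no_port_cycle n lab" for lab
    unfolding explored_def
  proof
    interpret grid n lab using n lab by unfold_locales
    fix c assume c: "c \<in> cells n"
    define R where "R = crun (act n lab) sync_rule 3 (\<lambda>_. (origin, 1), q0) (sync_schedule 3)"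
    define triple where "triple = (\<lambda>C :: (cell \<times> nat, sstate) cconf.
      ((fst C 0, snd C 0), (fst C 1, snd C 1), (fst C 2, snd C 2)))"
    have less_3: "j < 3 \<longleftrightarrow> j = 0 \<or> j = 1 \<or> j = 2" for j :: nat by auto
    have view: "view 3 C i = {q. (fst C i, q) \<in> {(fst C 0, snd C 0), (fst C 1, snd C 1), (fst C 2, snd C 2)}}"
      for C :: "(cell \<times> nat, sstate) cconf" and i
      unfolding view_def less_3 by auto
    have step: "triple (cstep (act n lab) sync_rule 3 (sync_schedule 3 t) C) = sync_step (triple C)" for C t
      unfolding triple_def sync_step_def cstep_def sync_agent_def sync_schedule_def Let_def prod.case view
      by simp
    have R: "triple (R t) = (sync_step ^^ t) (((origin, 1), Marker), ((origin, 1), SlowStart), ((origin, 1), FastStart))" for t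
    proof (induction t)
      case 0
      show ?case by (simp add: R_def triple_def q0_def)
    next
      case (Suc t)
      have "triple (R (Suc t)) = sync_step (triple (R t))" unfolding R_def crun.simps by (rule step)
      with Suc show ?case by simp
    qed
    obtain w p where w: "act_word (act n lab) w (origin, 1) = (c, p)"
      using act_word_reaches[OF c] by blast
    have "(origin, 1) \<in> corners n" using n by (auto simp: corners_def cells_def origin_def)
    from sync_word[OF this, of w] obtain t where "fst (fst (triple (R t))) = (c, p)"
      unfolding R w by blast
    then have "fst (fst (R t) 0) = c" by (simp add: triple_def)
    then have "fst (run n lab \<delta> 3 init (sync_schedule 3) t) 0 = c"
      using sim lab by (simp add: R_def)
    then show "\<exists>t i. i < 3 \<and> fst (run n lab \<delta> 3 init (sync_schedule 3) t) i = c"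
      by (intro exI[of _ t] exI[of _ 0]) simp
  qed
  with aut show ?thesis unfolding sync_explorable_def by blast
qed

section \<open>Four semi-synchronous agents\<close>

subsection \<open>A walker with three pebbles\<close>

text \<open>The instruction \<open>(i, g, g', q)\<close> of a walker program moves pebble \<open>i\<close>, if it is at the walker's
  corner, by \<open>g\<close>, and then the walker by \<open>g'\<close>. Agents 0, 1, 2 are the pebbles and agent 3 is the
  walker. The walker displays its order until the pebble has left, so that at any time a single
  agent can change the configuration, and the scheduler has no influence.\<close>

datatype 'p wstate = Pebble nat | Walker 'p | Order nat mv mv 'p

type_synonym 'p program = "'p \<Rightarrow> nat set \<Rightarrow> nat \<times> mv \<times> mv \<times> 'p"

fun pebble_rule :: "'p program \<Rightarrow> 'p wstate cautomaton" where
  "pebble_rule P (Pebble i) V =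
    (Pebble i, if \<exists>g g' q. Order i g g' q \<in> V then SOME g. \<exists>g' q. Order i g g' q \<in> V else Stay)"
| "pebble_rule P (Walker q) V =
    (case P q {i. Pebble i \<in> V} of (i, g, g', q') \<Rightarrow>
      if g = Stay \<or> Pebble i \<notin> V then (Walker q', g') else (Order i g g' q', Stay))"
| "pebble_rule P (Order i g g' q) V =
    (if Pebble i \<in> V then (Order i g g' q, Stay) else (Walker q, g'))"

definition pstep ::
    "(mv \<Rightarrow> 'x \<Rightarrow> 'x) \<Rightarrow> 'p program \<Rightarrow> 'p \<times> 'x \<times> (nat \<Rightarrow> 'x) \<Rightarrow> 'p \<times> 'x \<times> (nat \<Rightarrow> 'x)" where
  "pstep a P = (\<lambda>(q, w, p). case P q {i. i < 3 \<and> p i = w} of (i, g, g', q') \<Rightarrow>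
     (q', a g' w, if i < 3 \<and> p i = w then p(i := a g w) else p))"

definition represents :: "('x, 'p wstate) cconf \<Rightarrow> 'p wstate \<Rightarrow> 'x \<Rightarrow> (nat \<Rightarrow> 'x) \<Rightarrow> bool" where
  "represents C s w p \<longleftrightarrow> fst C 3 = w \<and> snd C 3 = s \<and> (\<forall>i<3. fst C i = p i \<and> snd C i = Pebble i)"

lemma represents_view:
  assumes "represents C s w p"
  shows "view 4 C a = {Pebble i | i. i < 3 \<and> p i = fst C a} \<union> (if w = fst C a then {s} else {})"
proof -
  have "j < 4 \<longleftrightarrow> j < 3 \<or> j = 3" for j :: nat by auto
  then have "q \<in> view 4 C a \<longleftrightarrow>
      (\<exists>j<3. q = snd C j \<and> fst C j = fst C a) \<or> q = snd C 3 \<and> fst C 3 = fst C a" for q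
    unfolding view_def by auto
  then show ?thesis using assms unfolding represents_def set_eq_iff by auto
qed

text \<open>\<open>I\<close> describes a phase that only agent \<open>i\<close> can end. Fairness
  provides its first activation from time \<open>t\<close> on, and until then \<open>I\<close>
  persists.\<close>

lemma fair_activation:
  assumes fair: "fair_schedule m sched" and i: "i < m" and I: "I (crun a D m c sched t)"
    and stay: "\<And>C A. I C \<Longrightarrow> i \<notin> A \<Longrightarrow> I (cstep a D m A C)"
    and move: "\<And>C A. I C \<Longrightarrow> i \<in> A \<Longrightarrow> J (cstep a D m A C)"
  shows "\<exists>t'. J (crun a D m c sched t')"
proof -
  have "\<exists>k. i \<in> sched (t + k)" using fair i unfolding fair_schedule_def by (metis le_add_diff_inverse)
  then obtain k where k: "i \<in> sched (t + k)" and least: "\<And>l. l < k \<Longrightarrow> i \<notin> sched (t + l)"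
    using exists_least_iff[of "\<lambda>k. i \<in> sched (t + k)"] by auto
  have "l \<le> k \<Longrightarrow> I (crun a D m c sched (t + l))" for l
    by (induction l) (use I stay least in auto)
  then have "J (crun a D m c sched (Suc (t + k)))" using move k by simp
  then show ?thesis ..
qed

context corner_space begin

text \<open>No order is on display, so activated pebbles stay and only agent 3 matters.\<close>

lemma represents_Walker:
  assumes C: "represents C (Walker q) w p" and p: "\<forall>i<3. p i \<in> X"
    and P: "P q {i. i < 3 \<and> p i = w} = (i, g, g', q')"
  shows "3 \<notin> A \<Longrightarrow> represents (cstep act (pebble_rule P) 4 A C) (Walker q) w p"
    and "3 \<in> A \<Longrightarrow> g = Stay \<or> \<not> (i < 3 \<and> p i = w) \<Longrightarrow>
      represents (cstep act (pebble_rule P) 4 A C) (Walker q') (act g' w) p"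
    and "3 \<in> A \<Longrightarrow> g \<noteq> Stay \<Longrightarrow> i < 3 \<Longrightarrow> p i = w \<Longrightarrow> w \<in> X \<Longrightarrow>
      represents (cstep act (pebble_rule P) 4 A C) (Order i g g' q') w p"
proof -
  note view = represents_view[OF C]
  have w: "fst C 3 = w" "snd C 3 = Walker q" and "\<And>i. i < 3 \<Longrightarrow> fst C i = p i \<and> snd C i = Pebble i"
    using C by (auto simp: represents_def)
  then have peb: "fst (cstep act (pebble_rule P) 4 A C) i = p i \<and>
      snd (cstep act (pebble_rule P) 4 A C) i = Pebble i" if "i < 3" for i
    using that p act_Stay by (auto simp: cstep_def view)
  have V: "{i. Pebble i \<in> view 4 C 3} = {i. i < 3 \<and> p i = w}"
    "Pebble i \<in> view 4 C 3 \<longleftrightarrow> i < 3 \<and> p i = w" using w by (auto simp: view)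
  show "3 \<notin> A \<Longrightarrow> represents (cstep act (pebble_rule P) 4 A C) (Walker q) w p"
    using peb w unfolding represents_def by (simp add: cstep_def)
  show "3 \<in> A \<Longrightarrow> g = Stay \<or> \<not> (i < 3 \<and> p i = w) \<Longrightarrow>
      represents (cstep act (pebble_rule P) 4 A C) (Walker q') (act g' w) p"
    using peb w V P unfolding represents_def by (auto simp: cstep_def)
  show "3 \<in> A \<Longrightarrow> g \<noteq> Stay \<Longrightarrow> i < 3 \<Longrightarrow> p i = w \<Longrightarrow> w \<in> X \<Longrightarrow>
      represents (cstep act (pebble_rule P) 4 A C) (Order i g g' q') w p"
    using peb w V P act_Stay unfolding represents_def by (auto simp: cstep_def)
qed

lemma represents_Order:
  assumes C: "represents C (Order i g g' q) w p" and p: "\<forall>i<3. p i \<in> X" and i: "i < 3" "p i = w"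
  shows "i \<notin> A \<Longrightarrow> represents (cstep act (pebble_rule P) 4 A C) (Order i g g' q) w p"
    and "i \<in> A \<Longrightarrow> represents (cstep act (pebble_rule P) 4 A C) (Order i g g' q) w (p(i := act g w))"
proof -
  note view = represents_view[OF C]
  have w: "fst C 3 = w" "snd C 3 = Order i g g' q"
    and p': "\<And>i. i < 3 \<Longrightarrow> fst C i = p i \<and> snd C i = Pebble i"
    using C by (auto simp: represents_def)
  have peb: "fst (cstep act (pebble_rule P) 4 A C) j = p j \<and>
      snd (cstep act (pebble_rule P) 4 A C) j = Pebble j" if "j < 3" "j \<noteq> i \<or> j \<notin> A" for j
    using that p p' act_Stay by (auto simp: cstep_def view)
  have pebi: "fst (cstep act (pebble_rule P) 4 A C) i = act g w \<and>
      snd (cstep act (pebble_rule P) 4 A C) i = Pebble i" if "i \<in> A"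
    using that i p' by (auto simp: cstep_def view)
  have "Pebble i \<in> view 4 C 3" "w \<in> X" using w i p by (auto simp: view)
  then have walker: "fst (cstep act (pebble_rule P) 4 A C) 3 = w \<and>
      snd (cstep act (pebble_rule P) 4 A C) 3 = Order i g g' q"
    using w act_Stay by (simp add: cstep_def)
  show "i \<notin> A \<Longrightarrow> represents (cstep act (pebble_rule P) 4 A C) (Order i g g' q) w p"
    using peb walker unfolding represents_def by blast
  show "i \<in> A \<Longrightarrow> represents (cstep act (pebble_rule P) 4 A C) (Order i g g' q) w (p(i := act g w))"
    using peb pebi walker unfolding represents_def by auto
qed

lemma represents_Order_done:
  assumes C: "represents C (Order i g g' q) w p" and p: "\<forall>i<3. p i \<in> X" and i: "p i \<noteq> w"
  shows "3 \<notin> A \<Longrightarrow> represents (cstep act (pebble_rule P) 4 A C) (Order i g g' q) w p"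
    and "3 \<in> A \<Longrightarrow> represents (cstep act (pebble_rule P) 4 A C) (Walker q) (act g' w) p"
proof -
  note view = represents_view[OF C]
  have w: "fst C 3 = w" "snd C 3 = Order i g g' q"
    and p': "\<And>i. i < 3 \<Longrightarrow> fst C i = p i \<and> snd C i = Pebble i"
    using C by (auto simp: represents_def)
  have peb: "fst (cstep act (pebble_rule P) 4 A C) j = p j \<and>
      snd (cstep act (pebble_rule P) 4 A C) j = Pebble j" if "j < 3" for j
    using that p p' i act_Stay by (auto simp: cstep_def view)
  have V: "Pebble i \<notin> view 4 C 3" using w i by (auto simp: view)
  show "3 \<notin> A \<Longrightarrow> represents (cstep act (pebble_rule P) 4 A C) (Order i g g' q) w p"
    using peb w unfolding represents_def by (simp add: cstep_def)
  show "3 \<in> A \<Longrightarrow> represents (cstep act (pebble_rule P) 4 A C) (Walker q) (act g' w) p"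
    using peb w V unfolding represents_def by (simp add: cstep_def)
qed

lemma fair_pstep:
  fixes P :: "'b program"
  assumes fair: "fair_schedule 4 sched"
    and C: "represents (crun act (pebble_rule P) 4 c sched t) (Walker q) w p"
    and w: "w \<in> X" and p: "\<forall>i<3. p i \<in> X"
    and step: "pstep act P (q, w, p) = (q', w', p')"
  shows "\<exists>t. represents (crun act (pebble_rule P) 4 c sched t) (Walker q') w' p'"
    and "w' \<in> X" and "\<forall>i<3. p' i \<in> X"
proof -
  obtain i g g' r where P: "P q {i. i < 3 \<and> p i = w} = (i, g, g', r)" by (metis prod_cases4)
  have eq: "q' = r" "w' = act g' w" "p' = (if i < 3 \<and> p i = w then p(i := act g w) else p)"
    using step by (simp_all add: pstep_def P)
  show "w' \<in> X" "\<forall>i<3. p' i \<in> X" using w p act_in by (auto simp: eq)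
  show "\<exists>t. represents (crun act (pebble_rule P) 4 c sched t) (Walker q') w' p'"
  \<comment> \<open>Obedience to an order to stay could not be observed, so no such order is
    displayed. A proper order takes three phases: the walker displays it, the pebble leaves, the
    walker notices and moves on.\<close>
  proof (cases "g = Stay \<or> \<not> (i < 3 \<and> p i = w)")
    case True
    then have p': "p' = p" using eq act_Stay[OF w] by auto
    show ?thesis unfolding p' eq(1,2)
    proof (rule fair_activation[OF fair, where i = 3 and I = "\<lambda>C. represents C (Walker q) w p"])
      fix C :: "('x, 'b wstate) cconf" and A assume C: "represents C (Walker q) w p"
      show "3 \<notin> A \<Longrightarrow> represents (cstep act (pebble_rule P) 4 A C) (Walker q) w p"
        by (rule represents_Walker(1)[where P = P, OF C p P])
      show "3 \<in> A \<Longrightarrow> represents (cstep act (pebble_rule P) 4 A C) (Walker r) (act g' w) p"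
        by (rule represents_Walker(2)[where P = P, OF C p P _ True])
    qed (use C in auto)
  next
    case False
    then have i: "i < 3" "p i = w" "g \<noteq> Stay" by auto
    let ?p = "p(i := act g w)"
    have p': "\<forall>i<3. ?p i \<in> X" "?p i \<noteq> w" using p act_in[OF w] act_neq[OF w] i by auto
    have "\<exists>t. represents (crun act (pebble_rule P) 4 c sched t) (Order i g g' r) w p"
    proof (rule fair_activation[OF fair, where i = 3 and I = "\<lambda>C. represents C (Walker q) w p"])
      fix C :: "('x, 'b wstate) cconf" and A assume C: "represents C (Walker q) w p"
      show "3 \<notin> A \<Longrightarrow> represents (cstep act (pebble_rule P) 4 A C) (Walker q) w p"
        by (rule represents_Walker(1)[where P = P, OF C p P])
      show "3 \<in> A \<Longrightarrow> represents (cstep act (pebble_rule P) 4 A C) (Order i g g' r) w p"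
        by (rule represents_Walker(3)[where P = P, OF C p P _ i(3,1,2) w])
    qed (use C in auto)
    then obtain t1 where t1: "represents (crun act (pebble_rule P) 4 c sched t1) (Order i g g' r) w p" ..
    have "\<exists>t. represents (crun act (pebble_rule P) 4 c sched t) (Order i g g' r) w ?p"
    proof (rule fair_activation[OF fair, where i = i and I = "\<lambda>C. represents C (Order i g g' r) w p"])
      fix C :: "('x, 'b wstate) cconf" and A assume C: "represents C (Order i g g' r) w p"
      show "i \<notin> A \<Longrightarrow> represents (cstep act (pebble_rule P) 4 A C) (Order i g g' r) w p"
        by (rule represents_Order(1)[OF C p i(1,2)])
      show "i \<in> A \<Longrightarrow> represents (cstep act (pebble_rule P) 4 A C) (Order i g g' r) w ?p"
        by (rule represents_Order(2)[OF C p i(1,2)])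
    qed (use i t1 in auto)
    then obtain t2 where t2: "represents (crun act (pebble_rule P) 4 c sched t2) (Order i g g' r) w ?p" ..
    have "\<exists>t. represents (crun act (pebble_rule P) 4 c sched t) (Walker r) (act g' w) ?p"
    proof (rule fair_activation[OF fair, where i = 3 and I = "\<lambda>C. represents C (Order i g g' r) w ?p"])
      fix C :: "('x, 'b wstate) cconf" and A assume C: "represents C (Order i g g' r) w ?p"
      show "3 \<notin> A \<Longrightarrow> represents (cstep act (pebble_rule P) 4 A C) (Order i g g' r) w ?p"
        by (rule represents_Order_done(1)[OF C p'])
      show "3 \<in> A \<Longrightarrow> represents (cstep act (pebble_rule P) 4 A C) (Walker r) (act g' w) ?p"
        by (rule represents_Order_done(2)[OF C p'])
    qed (use t2 in auto)
    then show ?thesis using i by (simp add: eq)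
  qed
qed

lemma fair_reaches:
  assumes fair: "fair_schedule 4 sched"
    and C: "represents (crun act (pebble_rule P) 4 c sched t) (Walker q) w p"
    and w: "w \<in> X" and p: "\<forall>i<3. p i \<in> X"
    and reaches: "reaches (pstep act P) (q, w, p) (q', w', p')"
  shows "\<exists>t. represents (crun act (pebble_rule P) 4 c sched t) (Walker q') w' p'"
proof -
  define I where "I = (\<lambda>(q, w, p). (\<exists>t. represents (crun act (pebble_rule P) 4 c sched t) (Walker q) w p)
    \<and> w \<in> X \<and> (\<forall>i<3. p i \<in> X))"
  obtain k where k: "(pstep act P ^^ k) (q, w, p) = (q', w', p')" using reaches by (auto simp: reaches_def)
  have "I ((pstep act P ^^ k) (q, w, p))"
  proof (induction k)
    case 0
    show ?case using C w p by (auto simp: I_def)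
  next
    case (Suc k)
    obtain q1 w1 p1 where 1: "(pstep act P ^^ k) (q, w, p) = (q1, w1, p1)" by (metis prod_cases3)
    obtain q2 w2 p2 where 2: "pstep act P (q1, w1, p1) = (q2, w2, p2)" by (metis prod_cases3)
    from Suc obtain t where t: "represents (crun act (pebble_rule P) 4 c sched t) (Walker q1) w1 p1"
      and "w1 \<in> X" "\<forall>i<3. p1 i \<in> X" by (auto simp: 1 I_def)
    from fair_pstep[OF fair this 2] show ?case by (simp add: 1 2 I_def)
  qed
  then show ?thesis by (simp add: k I_def)
qed

end

subsection \<open>The walker program\<close>

text \<open>Pebble 0 marks the base and pebble \<open>f\<close> is the far one; the near one, \<open>3 - f\<close>, waits at the base.
  Walking from the far pebble to the base the walker determines the instruction \<open>(s, g, m, k)\<close>.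
  The near pebble then starts at the new base, and in each round the far pebble is pulled by \<open>m\<close>
  towards the old base and the near pebble is pushed away by \<open>k\<close>, the marker being shifted between
  the two bases. The flag records that the far pebble has arrived and has been sent to the new base.\<close>

type_synonym instr = "ctl \<times> mv \<times> nat \<times> nat"

datatype pstate = Scan ctl nat nat | Seek nat instr | Pull nat instr nat | Home nat instr
  | Shift nat instr bool | Find nat instr bool | Push nat instr bool nat | Recall nat instr

fun walk :: "pstate program" where
  "walk (Scan s f r) V =
    (if 0 \<in> V then (3 - f, fst (snd (instr s r)), Stay, Seek f (instr s r))
     else (0, Stay, PiInv, Scan s f (Suc r mod modulus)))"
| "walk (Seek f (s, g, m, k)) V =
    (if f \<in> V then (0, Stay, Stay, Pull f (s, g, m, k) m) else (0, Stay, Pi, Seek f (s, g, m, k)))"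
| "walk (Pull f (s, g, m, k) j) V =
    (if j = 0
     then (if 0 \<in> V then (f, g, Stay, Shift f (s, g, m, k) True)
           else (0, Stay, Stay, Home f (s, g, m, k)))
     else (f, PiInv, PiInv, Pull f (s, g, m, k) (j - 1)))"
| "walk (Home f (s, g, m, k)) V =
    (if 0 \<in> V then (0, Stay, Stay, Shift f (s, g, m, k) False)
     else (0, Stay, PiInv, Home f (s, g, m, k)))"
| "walk (Shift f (s, g, m, k) b) V = (0, g, g, Find f (s, g, m, k) b)"
| "walk (Find f (s, g, m, k) b) V =
    (if 3 - f \<in> V then (0, Stay, Stay, Push f (s, g, m, k) b k)
     else (0, Stay, Pi, Find f (s, g, m, k) b))"
| "walk (Push f (s, g, m, k) b j) V =
    (if j = 0 then (0, Stay, Stay, if b then Scan s (3 - f) 0 else Recall f (s, g, m, k))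
     else (3 - f, Pi, Pi, Push f (s, g, m, k) b (j - 1)))"
| "walk (Recall f (s, g, m, k)) V =
    (if 0 \<in> V then (0, minv g, minv g, Seek f (s, g, m, k))
     else (0, Stay, PiInv, Recall f (s, g, m, k)))"

definition instrs :: "instr set" where
  "instrs = UNIV \<times> UNIV \<times> {..5 ^ 5} \<times> {..15}"

definition walk_states :: "pstate set" where
  "walk_states = (\<Union>f\<in>{1, 2}. (\<Union>s. Scan s f ` {..<modulus}) \<union>
    (\<Union>i\<in>instrs. {Seek f i, Home f i, Recall f i} \<union> Shift f i ` UNIV \<union> Find f i ` UNIV \<union>
      Pull f i ` {..5 ^ 5} \<union> (\<Union>b. Push f i b ` {..15})))"

lemma walk_states_iff [simp]:
  "Scan s f r \<in> walk_states \<longleftrightarrow> f \<in> {1, 2} \<and> r < modulus"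
  "Seek f i \<in> walk_states \<longleftrightarrow> f \<in> {1, 2} \<and> i \<in> instrs"
  "Home f i \<in> walk_states \<longleftrightarrow> f \<in> {1, 2} \<and> i \<in> instrs"
  "Recall f i \<in> walk_states \<longleftrightarrow> f \<in> {1, 2} \<and> i \<in> instrs"
  "Shift f i b \<in> walk_states \<longleftrightarrow> f \<in> {1, 2} \<and> i \<in> instrs"
  "Find f i b \<in> walk_states \<longleftrightarrow> f \<in> {1, 2} \<and> i \<in> instrs"
  "Pull f i j \<in> walk_states \<longleftrightarrow> f \<in> {1, 2} \<and> i \<in> instrs \<and> j \<le> 5 ^ 5"
  "Push f i b j \<in> walk_states \<longleftrightarrow> f \<in> {1, 2} \<and> i \<in> instrs \<and> j \<le> 15"
  by (auto simp: walk_states_def image_iff)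

lemma finite_walk_states: "finite walk_states"
proof -
  have "finite instrs" unfolding instrs_def using finite_ctl finite_mv by simp
  then show ?thesis unfolding walk_states_def using finite_ctl by simp
qed

lemma instr_in_instrs: "instr s r \<in> instrs"
  using instr_bound[of s r] by (cases "instr s r") (auto simp: instrs_def)

lemma instrs_iff: "(s, g, m, k) \<in> instrs \<longleftrightarrow> m \<le> 5 ^ 5 \<and> k \<le> 15"
  by (auto simp: instrs_def)

lemma walk_closed:
  assumes "q \<in> walk_states" "walk q V = (i, g, g', q')"
  shows "i < 3" "q' \<in> walk_states"
proof -
  note [simp] = modulus_pos instr_in_instrs instrs_iff
  have "i < 3 \<and> q' \<in> walk_states"
  proof (cases q)
    case (Scan s f r)
    then show ?thesis using assms by (auto split: if_splits)
  next
    case (Seek f a)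
    then show ?thesis using assms by (cases a) (auto split: if_splits)
  next
    case (Pull f a j)
    then show ?thesis using assms by (cases a) (auto split: if_splits)
  next
    case (Home f a)
    then show ?thesis using assms by (cases a) (auto split: if_splits)
  next
    case (Shift f a b)
    then show ?thesis using assms by (cases a) (auto split: if_splits)
  next
    case (Find f a b)
    then show ?thesis using assms by (cases a) (auto split: if_splits)
  next
    case (Push f a b j)
    then show ?thesis using assms by (cases a) (auto split: if_splits)
  next
    case (Recall f a)
    then show ?thesis using assms by (cases a) (auto split: if_splits)
  qed
  then show "i < 3" "q' \<in> walk_states" by auto
qed

definition ssync_states :: "pstate wstate set" where
  "ssync_states = Pebble ` {..<3} \<union> Walker ` walk_states \<union>
    (\<Union>i<3. \<Union>g. \<Union>g'. Order i g g' ` walk_states)"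

lemma ssync_states_iff [simp]:
  "Pebble i \<in> ssync_states \<longleftrightarrow> i < 3"
  "Walker q \<in> ssync_states \<longleftrightarrow> q \<in> walk_states"
  "Order i g g' q \<in> ssync_states \<longleftrightarrow> i < 3 \<and> q \<in> walk_states"
  by (auto simp: ssync_states_def image_iff)

lemma finite_ssync_states: "finite ssync_states"
  unfolding ssync_states_def using finite_walk_states finite_mv by simp

lemma pebble_rule_closed:
  assumes "s \<in> ssync_states" shows "fst (pebble_rule walk s V) \<in> ssync_states"
proof (cases s)
  case (Walker q)
  obtain i g g' q' where P: "walk q {i. Pebble i \<in> V} = (i, g, g', q')" by (metis prod_cases4)
  then show ?thesis using walk_closed[OF _ P] assms Walker by simp
qed (use assms in auto)

text \<open>Base, far and near pebble. The common default at other indices makes moves and the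
  exchange of \<open>f\<close> and \<open>3 - f\<close> equations between functions.\<close>

definition peb :: "nat \<Rightarrow> 'x \<Rightarrow> 'x \<Rightarrow> 'x \<Rightarrow> nat \<Rightarrow> 'x" where
  "peb f x y z = (\<lambda>i. if i = 0 then x else if i = f then y else if i = 3 - f then z else undefined)"

lemma peb_simps:
  assumes "f \<in> {1, 2}"
  shows "peb f x y z 0 = x" "peb f x y z f = y" "peb f x y z (3 - f) = z"
    "(peb f x y z)(0 := x') = peb f x' y z" "(peb f x y z)(f := y') = peb f x y' z"
    "(peb f x y z)(3 - f := z') = peb f x y z'"
  using assms by (auto simp: peb_def)

lemma peb_swap: "f \<in> {1, 2} \<Longrightarrow> peb (3 - f) x y z = peb f x z y"
  by (auto simp: peb_def)

context corner_space begin

section \<open>Correctness of the walker program\<close>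

abbreviation "wstep \<equiv> pstep act walk"

lemma pstep_walk:
  assumes "w \<in> X" "P q {i. i < 3 \<and> p i = w} = (i, Stay, g, q')"
  shows "pstep act P (q, w, p) = (q', act g w, p)"
  using assms act_Stay[OF assms(1)] by (auto simp: pstep_def)

lemma pstep_move:
  assumes "P q {i. i < 3 \<and> p i = w} = (i, g, g', q')" "i < 3" "p i = w"
  shows "pstep act P (q, w, p) = (q', act g' w, p(i := act g w))"
  using assms by (auto simp: pstep_def)

text \<open>The line never repeats a corner, so pebble \<open>f\<close> is not met early; other
  pebbles on the way are told apart by their numbers.\<close>

lemma reaches_forward:
  assumes x: "x \<in> X" and f: "f < 3" "p f = line x d"
    and P: "\<And>V. f \<notin> V \<Longrightarrow> P q V = (0, Stay, Pi, q)"
  shows "reaches (pstep act P) (q, x, p) (q, line x d, p)"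
proof -
  have "j \<le> d \<Longrightarrow> reaches (pstep act P) (q, x, p) (q, line x j, p)" for j
  proof (induction j)
    case 0
    show ?case by auto
  next
    case (Suc j)
    have "pstep act P (q, line x j, p) = (q, act Pi (line x j), p)"
      by (rule pstep_walk[where P = P, OF line_in[OF x] P]) (use f line_eq_iff[OF x] Suc.prems in auto)
    with Suc show ?case by (intro reaches_Suc[OF Suc.IH]) auto
  qed
  then show ?thesis by blast
qed

lemma reaches_back:
  assumes x: "x \<in> X" and f: "f < 3" "p f = x"
    and P: "\<And>V. f \<notin> V \<Longrightarrow> P q V = (0, Stay, PiInv, q)"
  shows "reaches (pstep act P) (q, line x d, p) (q, x, p)"
proof (induction d)
  case 0
  show ?case by auto
next
  case (Suc d)
  have "pstep act P (q, line x (Suc d), p) = (q, act PiInv (line x (Suc d)), p)"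
    by (rule pstep_walk[where P = P, OF line_in[OF x] P]) (use f line_eq_self_iff[OF x, of "Suc d"] in auto)
  with Suc show ?case unfolding PiInv_line[OF x] by - (rule reaches_step, simp del: funpow.simps)
qed

lemma reaches_Scan:
  assumes x: "x \<in> X" and p: "p 0 = x"
  shows "reaches wstep (Scan s f (r mod modulus), line x d, p) (Scan s f ((r + d) mod modulus), x, p)"
proof (induction d arbitrary: r)
  case 0
  show ?case by auto
next
  case (Suc d)
  have "wstep (Scan s f (r mod modulus), line x (Suc d), p) =
      (Scan s f (Suc (r mod modulus) mod modulus), act PiInv (line x (Suc d)), p)"
    by (rule pstep_walk[OF line_in[OF x]]) (use p line_eq_self_iff[OF x, of "Suc d"] in auto)
  with Suc[of "Suc r"] show ?case
    unfolding PiInv_line[OF x] mod_Suc_eq by - (rule reaches_step, simp del: funpow.simps)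
qed

lemma reaches_Pull:
  assumes x: "x \<in> X" and f: "f \<in> {1, 2}"
  shows "reaches wstep (Pull f (s, g, m, k) j, line x (i + j), peb f a (line x (i + j)) z)
    (Pull f (s, g, m, k) 0, line x i, peb f a (line x i) z)"
proof (induction j)
  case 0
  show ?case by auto
next
  case (Suc j)
  have "wstep (Pull f (s, g, m, k) (Suc j), line x (Suc (i + j)), peb f a (line x (Suc (i + j))) z) =
      (Pull f (s, g, m, k) j, act PiInv (line x (Suc (i + j))),
        (peb f a (line x (Suc (i + j))) z)(f := act PiInv (line x (Suc (i + j)))))"
    by (rule pstep_move) (use f peb_simps(2)[OF f] in auto)
  with Suc show ?case
    unfolding PiInv_line[OF x] peb_simps(5)[OF f] add_Suc_right
    by - (rule reaches_step, simp del: funpow.simps)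
qed

lemma reaches_Push:
  assumes f: "f \<in> {1, 2}"
  shows "reaches wstep (Push f (s, g, m, k) b j, line x i, peb f a y (line x i))
    (Push f (s, g, m, k) b 0, line x (i + j), peb f a y (line x (i + j)))"
proof (induction j arbitrary: i)
  case 0
  show ?case by auto
next
  case (Suc j)
  have "wstep (Push f (s, g, m, k) b (Suc j), line x i, peb f a y (line x i)) =
      (Push f (s, g, m, k) b j, act Pi (line x i), (peb f a y (line x i))(3 - f := act Pi (line x i)))"
    by (rule pstep_move) (use f peb_simps(3)[OF f] in auto)
  with Suc[of "Suc i"] show ?case
    unfolding peb_simps(6)[OF f] by - (rule reaches_step, simp)
qed

lemma wstep_Stay:
  assumes "w \<in> X" "walk q {i. i < 3 \<and> p i = w} = (0, Stay, Stay, q')"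
  shows "reaches wstep (q, w, p) (q', w, p)"
  using pstep_walk[of w walk q p 0 Stay q'] assms act_Stay by (intro reaches_Suc[OF reaches_refl]) auto

lemma reaches_Find:
  assumes x: "x \<in> X" and f: "f \<in> {1, 2}" and y: "y = act g x"
  shows "reaches wstep (Shift f (s, g, m, k) b, x, peb f x u (line y d))
    (Push f (s, g, m, k) b 0, line y (d + k), peb f y u (line y (d + k)))"
proof -
  have yX: "y \<in> X" using act_in[OF x] by (simp add: y)
  have "wstep (Shift f (s, g, m, k) b, x, peb f x u (line y d)) =
      (Find f (s, g, m, k) b, y, (peb f x u (line y d))(0 := y))"
    unfolding y by (rule pstep_move) (auto simp: peb_simps[OF f])
  then have "reaches wstep (Shift f (s, g, m, k) b, x, peb f x u (line y d))
      (Find f (s, g, m, k) b, y, peb f y u (line y d))"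
    unfolding peb_simps(4)[OF f] by (rule reaches_Suc[OF reaches_refl])
  also have "reaches wstep \<dots> (Find f (s, g, m, k) b, line y d, peb f y u (line y d))"
    by (rule reaches_forward[OF yX, where f = "3 - f"]) (use f peb_simps(3)[OF f] in auto)
  also have "reaches wstep \<dots> (Push f (s, g, m, k) b k, line y d, peb f y u (line y d))"
    by (rule wstep_Stay[OF line_in[OF yX]]) (use f peb_simps(3)[OF f] in auto)
  also have "reaches wstep \<dots> (Push f (s, g, m, k) b 0, line y (d + k), peb f y u (line y (d + k)))"
    by (rule reaches_Push[OF f])
  finally show ?thesis .
qed

lemma reaches_Seek:
  assumes x: "x \<in> X" and f: "f \<in> {1, 2}"
  shows "reaches wstep (Seek f (s, g, m, k), x, peb f x (line x (d + m)) z)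
    (Pull f (s, g, m, k) 0, line x d, peb f x (line x d) z)"
proof -
  have "reaches wstep (Seek f (s, g, m, k), x, peb f x (line x (d + m)) z)
      (Seek f (s, g, m, k), line x (d + m), peb f x (line x (d + m)) z)"
    by (rule reaches_forward[OF x, where f = f]) (use f peb_simps(2)[OF f] in auto)
  also have "reaches wstep \<dots> (Pull f (s, g, m, k) m, line x (d + m), peb f x (line x (d + m)) z)"
    by (rule wstep_Stay[OF line_in[OF x]]) (use f peb_simps(2)[OF f] in auto)
  also have "reaches wstep \<dots> (Pull f (s, g, m, k) 0, line x d, peb f x (line x d) z)"
    by (rule reaches_Pull[OF x f])
  finally show ?thesis .
qed

text \<open>One marker serves both bases: it ends the walk back in \<open>Home\<close> at
  \<open>x\<close> and, once shifted, the walk back in \<open>Recall\<close> at \<open>y\<close>.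
  From there \<open>minv g\<close> leads to \<open>x\<close> again. As \<open>0 < d\<close>, the far
  pebble has not arrived yet.\<close>

lemma reaches_round:
  assumes x: "x \<in> X" and f: "f \<in> {1, 2}" and y: "y = act g x" and d: "0 < d"
  shows "reaches wstep (Seek f (s, g, m, k), x, peb f x (line x (d + m)) (line y e))
    (Seek f (s, g, m, k), x, peb f x (line x d) (line y (e + k)))"
proof -
  have yX: "y \<in> X" using act_in[OF x] by (simp add: y)
  have "line x d \<noteq> x" using line_eq_self_iff[OF x] d by simp
  have "reaches wstep (Seek f (s, g, m, k), x, peb f x (line x (d + m)) (line y e))
      (Pull f (s, g, m, k) 0, line x d, peb f x (line x d) (line y e))"
    by (rule reaches_Seek[OF x f])
  also have "reaches wstep \<dots> (Home f (s, g, m, k), line x d, peb f x (line x d) (line y e))"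
    by (rule wstep_Stay[OF line_in[OF x]]) (use \<open>line x d \<noteq> x\<close> in \<open>auto simp: peb_simps(1)[OF f]\<close>)
  also have "reaches wstep \<dots> (Home f (s, g, m, k), x, peb f x (line x d) (line y e))"
    by (rule reaches_back[OF x, where f = 0]) (use peb_simps(1)[OF f] in auto)
  also have "reaches wstep \<dots> (Shift f (s, g, m, k) False, x, peb f x (line x d) (line y e))"
    by (rule wstep_Stay[OF x]) (use peb_simps(1)[OF f] in auto)
  also have "reaches wstep \<dots> (Push f (s, g, m, k) False 0, line y (e + k), peb f y (line x d) (line y (e + k)))"
    by (rule reaches_Find[OF x f y])
  also have "reaches wstep \<dots> (Recall f (s, g, m, k), line y (e + k), peb f y (line x d) (line y (e + k)))"
    by (rule wstep_Stay[OF line_in[OF yX]]) auto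
  also have "reaches wstep \<dots> (Recall f (s, g, m, k), y, peb f y (line x d) (line y (e + k)))"
    by (rule reaches_back[OF yX, where f = 0]) (use peb_simps(1)[OF f] in auto)
  also have "reaches wstep \<dots> (Seek f (s, g, m, k), x, peb f x (line x d) (line y (e + k)))"
  proof (rule reaches_Suc[OF reaches_refl])
    have "wstep (Recall f (s, g, m, k), y, peb f y (line x d) (line y (e + k))) =
        (Seek f (s, g, m, k), act (minv g) y, (peb f y (line x d) (line y (e + k)))(0 := act (minv g) y))"
      by (rule pstep_move) (use peb_simps(1)[OF f] in auto)
    moreover have "act (minv g) y = x" using act_minv[OF x] by (simp add: y)
    ultimately show "wstep (Recall f (s, g, m, k), y, peb f y (line x d) (line y (e + k))) =
        (Seek f (s, g, m, k), x, peb f x (line x d) (line y (e + k)))"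
      by (simp only: peb_simps(4)[OF f])
  qed
  finally show ?thesis .
qed

text \<open>The far pebble is now at the old base and is sent to the new one, where it will be the
  near pebble; hence \<open>3 - f\<close>.\<close>

lemma reaches_last_round:
  assumes x: "x \<in> X" and f: "f \<in> {1, 2}" and y: "y = act g x"
  shows "reaches wstep (Seek f (s, g, m, k), x, peb f x (line x m) (line y e))
    (Scan s (3 - f) 0, line y (e + k), peb f y y (line y (e + k)))"
proof -
  have yX: "y \<in> X" using act_in[OF x] by (simp add: y)
  have "reaches wstep (Seek f (s, g, m, k), x, peb f x (line x m) (line y e))
      (Pull f (s, g, m, k) 0, x, peb f x x (line y e))"
    using reaches_Seek[OF x f, of s g m k 0] by simp
  also have "reaches wstep \<dots> (Shift f (s, g, m, k) True, x, peb f x y (line y e))"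
  proof (rule reaches_Suc[OF reaches_refl])
    have "wstep (Pull f (s, g, m, k) 0, x, peb f x x (line y e)) =
        (Shift f (s, g, m, k) True, act Stay x, (peb f x x (line y e))(f := act g x))"
      by (rule pstep_move) (use f peb_simps(1,2)[OF f] in auto)
    then show "wstep (Pull f (s, g, m, k) 0, x, peb f x x (line y e)) =
        (Shift f (s, g, m, k) True, x, peb f x y (line y e))"
      by (simp only: peb_simps(5)[OF f] act_Stay[OF x] y)
  qed
  also have "reaches wstep \<dots> (Push f (s, g, m, k) True 0, line y (e + k), peb f y y (line y (e + k)))"
    by (rule reaches_Find[OF x f y])
  also have "reaches wstep \<dots> (Scan s (3 - f) 0, line y (e + k), peb f y y (line y (e + k)))"
    by (rule wstep_Stay[OF line_in[OF yX]]) auto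
  finally show ?thesis .
qed

lemma reaches_rounds:
  assumes x: "x \<in> X" and f: "f \<in> {1, 2}" and y: "y = act g x" and m: "0 < m"
  shows "reaches wstep (Seek f (s, g, m, k), x, peb f x (line x (m * Suc c)) (line y e))
    (Scan s (3 - f) 0, line y (e + k * Suc c), peb f y y (line y (e + k * Suc c)))"
proof (induction c arbitrary: e)
  case 0
  show ?case using reaches_last_round[OF x f y] by simp
next
  case (Suc c)
  have "reaches wstep (Seek f (s, g, m, k), x, peb f x (line x (m * Suc c + m)) (line y e))
      (Seek f (s, g, m, k), x, peb f x (line x (m * Suc c)) (line y (e + k)))"
    by (rule reaches_round[OF x f y]) (use m in simp)
  also have "reaches wstep \<dots>
      (Scan s (3 - f) 0, line y (e + k + k * Suc c), peb f y y (line y (e + k + k * Suc c)))"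
    by (rule Suc.IH)
  also have "e + k + k * Suc c = e + k * Suc (Suc c)" by simp
  finally show ?case by (simp only: mult_Suc_right add.commute[of m])
qed

definition ssync_conf where
  "ssync_conf f = (\<lambda>(s, x, d). (Scan s f 0, line x d, peb f x (line x d) x))"

lemma ssync_fstep:
  assumes x: "x \<in> X" and d: "0 < d" and f: "f \<in> {1, 2}"
  shows "reaches wstep (ssync_conf f (s, x, d)) (ssync_conf (3 - f) (fstep act (s, x, d)))"
proof -
  obtain s' g m k where i: "instr s (d mod modulus) = (s', g, m, k)" by (metis prod_cases4)
  note dvd = instr_cases[OF i]
  define y where "y = act g x"
  obtain c where c: "d = m * c" using dvd(1) by blast
  then obtain c' where c': "c = Suc c'" using d by (cases c) auto
  have "reaches wstep (ssync_conf f (s, x, d)) (Scan s f (d mod modulus), x, peb f x (line x d) x)"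
    using reaches_Scan[where p = "peb f x (line x d) x" and s = s and f = f and r = 0 and d = d,
        OF x peb_simps(1)[OF f]]
    by (simp add: ssync_conf_def)
  also have "reaches wstep \<dots> (Seek f (s', g, m, k), x, peb f x (line x d) (line y 0))"
  proof (rule reaches_Suc[OF reaches_refl])
    have "wstep (Scan s f (d mod modulus), x, peb f x (line x d) x) =
        (Seek f (s', g, m, k), act Stay x, (peb f x (line x d) x)(3 - f := act g x))"
      by (rule pstep_move) (use f i peb_simps(1,3)[OF f] in auto)
    then show "wstep (Scan s f (d mod modulus), x, peb f x (line x d) x) =
        (Seek f (s', g, m, k), x, peb f x (line x d) (line y 0))"
      by (simp only: peb_simps(6)[OF f] act_Stay[OF x] y_def funpow_0)
  qed
  also have "reaches wstep \<dots> (Scan s' (3 - f) 0, line y (0 + k * c), peb f y y (line y (0 + k * c)))"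
    unfolding c c' by (rule reaches_rounds[OF x f y_def dvd(2)])
  also have "\<dots> = ssync_conf (3 - f) (s', y, d div m * k)"
    using dvd(2) by (simp add: ssync_conf_def peb_swap[OF f] c mult.commute)
  also have "(s', y, d div m * k) = fstep act (s, x, d)" by (simp add: fstep_def i y_def)
  finally show ?thesis .
qed

lemma ssync_word:
  assumes x: "x \<in> X"
  shows "\<exists>q v p. reaches wstep (Push 1 (Return, Stay, 1, 1) True 1, x, peb 1 x x x) (q, v, p) \<and>
    p 0 = act_word act w x"
proof -
  define R where "R = (\<lambda>(s, x, d) e. x \<in> X \<and> 0 < d \<and> (\<exists>f\<in>{1, 2}. e = ssync_conf f (s, x, d)))"
  obtain s d where "reaches (fstep act) (Return, x, 1) (s, act_word act w x, d)"
    using reaches_word[OF x] by blast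
  then have "\<exists>e. reaches wstep (ssync_conf 2 (Return, x, 1)) e \<and> R (s, act_word act w x, d) e"
  proof (rule reaches_simulation)
    show "R (Return, x, 1) (ssync_conf 2 (Return, x, 1))" using x by (simp add: R_def)
    fix c e assume "R c e"
    then obtain s x d f where c: "c = (s, x, d)" "x \<in> X" "0 < d" "f \<in> {1, 2}" "e = ssync_conf f (s, x, d)"
      by (cases c) (auto simp: R_def)
    obtain s' x' d' where f: "fstep act (s, x, d) = (s', x', d')" by (metis prod_cases3)
    have "3 - f \<in> {1, 2}" using c(4) by auto
    then show "\<exists>e'. reaches wstep e e' \<and> R (fstep act c) e'"
      using ssync_fstep[OF c(2,3,4), of s] fstep_in[OF c(2,3) f]
      by (intro exI[of _ "ssync_conf (3 - f) (s', x', d')"]) (auto simp: c(1,5) f R_def)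
  qed
  then obtain e f where "reaches wstep (ssync_conf 2 (Return, x, 1)) e" "f \<in> {1, 2}"
    "e = ssync_conf f (s, act_word act w x, d)" unfolding R_def by blast
  note e = this
  \<comment> \<open>The initial state is the end of a fictitious last round. It pushes pebble 2 one
    step away from the common corner and so lays out the number 1.\<close>
  have "reaches wstep (Push 1 (Return, Stay, 1, 1) True 1, x, peb 1 x x x)
      (Push 1 (Return, Stay, 1, 1) True 0, line x 1, peb 1 x x (line x 1))"
    using reaches_Push[where f = 1 and s = Return and g = Stay and m = 1 and k = 1 and b = True
        and j = 1 and x = x and i = 0 and a = x and y = x] by simp
  also have "reaches wstep \<dots> (Scan Return 2 0, line x 1, peb 1 x x (line x 1))"
    by (rule wstep_Stay[OF line_in[OF x]]) auto
  also have "\<dots> = ssync_conf 2 (Return, x, 1)"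
    using peb_swap[of 1 x "line x 1" x] by (simp add: ssync_conf_def)
  also have "reaches wstep \<dots> e" by (rule e(1))
  finally have "reaches wstep (Push 1 (Return, Stay, 1, 1) True 1, x, peb 1 x x x)
      (Scan s f 0, line (act_word act w x) d,
        peb f (act_word act w x) (line (act_word act w x) d) (act_word act w x))"
    unfolding e(3) ssync_conf_def by simp
  with peb_simps(1)[OF e(2)] show ?thesis by (intro exI conjI)
qed

end

section \<open>Transfer to the grid: four agents\<close>

lemma ssync_explorable_4:
  assumes n: "1 \<le> n" shows "ssync_explorable n 4"
proof -
  define q0 where "q0 = (\<lambda>i :: nat. if i < 3 then Pebble i else Walker (Push 1 (Return, Stay, 1, 1) True 1))"
  have q0: "q0 i \<in> ssync_states" for i by (simp add: q0_def instrs_def)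
  have "\<exists>Q \<delta> init. is_automaton n Q \<delta> \<and> (\<forall>i<4. init i \<in> Q) \<and>
    (\<forall>lab sched t i. valid_labelling n lab \<longrightarrow> no_port_cycle n lab \<longrightarrow> i < 4 \<longrightarrow>
      fst (run n lab \<delta> 4 init sched t) i =
      fst (fst (crun (act n lab) (pebble_rule walk) 4 (\<lambda>_. (origin, 1), q0) sched t) i))"
    by (rule corner_automaton_implementable[OF n finite_ssync_states pebble_rule_closed q0])
  then obtain Q \<delta> init where aut: "is_automaton n Q \<delta>" "\<forall>i<4. init i \<in> Q"
    and sim: "\<forall>lab sched t i. valid_labelling n lab \<longrightarrow> no_port_cycle n lab \<longrightarrow> i < 4 \<longrightarrow>
      fst (run n lab \<delta> 4 init sched t) i =
      fst (fst (crun (act n lab) (pebble_rule walk) 4 (\<lambda>_. (origin, 1), q0) sched t) i)" by blast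
  have "explored n lab \<delta> 4 init sched"
    if lab: "valid_labelling n lab" "no_port_cycle n lab" and fair: "fair_schedule 4 sched" for lab sched
    unfolding explored_def
  proof
    interpret grid n lab using n lab by unfold_locales
    fix c assume c: "c \<in> cells n"
    let ?o = "(origin, 1 :: nat)"
    let ?q = "Push 1 (Return, Stay, 1, 1) True 1"
    have o: "?o \<in> corners n" using n by (auto simp: corners_def cells_def origin_def)
    obtain w p where w: "act_word (act n lab) w ?o = (c, p)" using act_word_reaches[OF c] by blast
    obtain q v u where *: "reaches (pstep (act n lab) walk) (?q, ?o, peb 1 ?o ?o ?o) (q, v, u)" "u 0 = (c, p)"
      using ssync_word[OF o, of w] unfolding w by blast
    have peb: "peb 1 ?o ?o ?o i = ?o" if "i < 3" for i using that by (auto simp: peb_def)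
    have "represents (crun (act n lab) (pebble_rule walk) 4 (\<lambda>_. ?o, q0) sched 0) (Walker ?q) ?o (peb 1 ?o ?o ?o)"
      using peb by (simp add: represents_def q0_def)
    from fair_reaches[OF fair this o _ *(1)] peb o
    obtain t where "represents (crun (act n lab) (pebble_rule walk) 4 (\<lambda>_. ?o, q0) sched t) (Walker q) v u"
      by auto
    then have "fst (fst (crun (act n lab) (pebble_rule walk) 4 (\<lambda>_. ?o, q0) sched t) 0) = c"
      using *(2) by (simp add: represents_def)
    then have "fst (run n lab \<delta> 4 init sched t) 0 = c" using sim lab by simp
    then show "\<exists>t i. i < 4 \<and> fst (run n lab \<delta> 4 init sched t) i = c"
      by (intro exI[of _ t] exI[of _ 0]) simp
  qed
  with aut show ?thesis unfolding ssync_explorable_def by blast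
qed

theorem theorem1p2:
  fixes n :: nat
  assumes "n \<ge> 1"
  shows "sync_explorable n 3 \<and> ssync_explorable n 4"
  using sync_explorable_3[OF assms] ssync_explorable_4[OF assms] ..

end
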